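(* Let $\varphi:\mathbb R^n\to\overline{\mathbb R}$ be proper, lower semicontinuous and prox-bounded, and let $\bar x$ satisfy $0\in\partial\varphi(\bar x)$. Suppose that $\partial\varphi$ is metrically regular around $(\bar x,0)$ and semismooth$^*$ at $(\bar x,0)$, and that $\varphi$ is continuously prox-regular at $\bar x$ for $0$. Let $\eta>0$ be the parameter of the coderivative-based Newton algorithm described in the context. Then there is a neighborhood $U$ of $\bar x$ such that, whenever $x^0\in U$, the algorithm started at $x^0$ either stops after finitely many iterations, or produces a sequence $\{x^k\}$ that converges $Q$-superlinearly to $\bar x$ as $k\to\infty$.
   Context: $\overline{\mathbb R}=(-\infty,\infty]$. For a set $\Omega\subset\mathbb R^s$ and $\bar z\in\Omega$: $\widehat N_\Omega(\bar z)=\{v:\limsup_{z\to\bar z,\,z\in\Omega}\langle v,z-\bar z\rangle/\|z-\bar z\|\le 0\}$ (regular normal cone); $N_\Omega(\bar z)=\{v:\exists z_k\to\bar z,\ z_k\in\Omega,\ v_k\to v,\ v_k\in\widehat N_\Omega(z_k)\}$ (limiting normal cone); for a direction $d\in\mathbb R^s$, $N_\Omega(\bar z;d)=\{v:\exists t_k\downarrow 0,\ d_k\to d,\ v_k\to v,\ v_k\in\widehat N_\Omega(\bar z+t_kd_k)\}$. Limiting subdifferential: $\partial\varphi(x)=\{v:(v,-1)\in N_{\mathrm{epi}\,\varphi}(x,\varphi(x))\}$ for $x\in\mathrm{dom}\,\varphi$ (empty otherwise). For a set-valued $F:\mathbb R^n\rightrightarrows\mathbb R^m$ and $(\bar x,\bar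 y)\in\mathrm{gph}\,F$: $D^*F(\bar x,\bar y)(v)=\{u:(u,-v)\in N_{\mathrm{gph}F}(\bar x,\bar y)\}$ and $D^*F((\bar x,\bar y);(u,v))(v^* )=\{u^*:(u^*,-v^* )\in N_{\mathrm{gph}F}((\bar x,\bar y);(u,v))\}$. Second-order subdifferential: $\partial^2\varphi(x,v)(u)=(D^*\partial\varphi)(x,v)(u)$ for $(x,v)\in\mathrm{gph}\,\partial\varphi$. $F$ is metrically regular around $(\bar x,\bar y)$ if there are $\mu>0$ and neighborhoods $U$ of $\bar x$, $V$ of $\bar y$ with $\mathrm{dist}(x;F^{-1}(y))\le\mu\,\mathrm{dist}(y;F(x))$ for all $(x,y)\in U\times V$. $F$ is semismooth$^*$ at $(\bar x,\bar y)$ if for all $(u,v)$ one has $\langle u^*,u\rangle=\langle v^*,v\rangle$ whenever $u^*\in D^*F((\bar x,\bar y);(u,v))(v^* )$. $\varphi$ is prox-bounded if for some $\lambda>0$ and some $x$, $\inf_y\{\varphi(y)+\frac1{2\lambda}\|y-x\|^2\}>-\infty$. A function $\psi$ is $s$-convex ($s\in\mathbb R$) if $\psi-\frac s2\|\cdot\|^2$ is convex. A proper l.s.c. $\varphi$ is variationally $s$-convex at $\bar x$ for $\bar v\in\partial\varphi(\bar x)$ if there are an $s$-convex function $\widehat\varphi$, convex neighborhoods $U$ of $\bar x$ and $V$ of $\bar v$, and $\varepsilon>0$ such that $\widehat\varphi\le\varphi$ on $U$, $(U\times V)\cap\mathrm{gph}\,\partial\widehat\varphi=(U_\varepsilon\times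 V)\cap\mathrm{gph}\,\partial\varphi$, and $\widehat\varphi(x)=\varphi(x)$ at the common elements $(x,v)$, where $U_\varepsilon=\{x\in U:\varphi(x)<\varphi(\bar x)+\varepsilon\}$. $\varphi$ is prox-regular at $\bar x$ for $\bar v$ if it is variationally $s$-convex there for some $s\le 0$. $\varphi$ is subdifferentially continuous at $\bar x$ for $\bar v$ if for every $\varepsilon>0$ there is $\delta>0$ with $|\varphi(x)-\varphi(\bar x)|<\varepsilon$ for all $(x,v)\in\mathrm{gph}\,\partial\varphi$ with $\|x-\bar x\|\le\delta$, $\|v-\bar v\|\le\delta$. Continuously prox-regular = prox-regular and subdifferentially continuous. Algorithm (with parameter $\eta>0$ and starting point $x^0\in\mathbb R^n$). For $k=0,1,\dots$: if $0\in\partial\varphi(x^k)$, stop. Otherwise: (approximate step) find $(\hat x^k,\hat v^k)\in\mathrm{gph}\,\partial\varphi$ with $\|(\hat x^k,\hat v^k)-(\bar x,0)\|\le\eta\|x^k-\bar x\|$; (Newton step) choose $d^k\in\mathbb R^n$ with $-\hat v^k\in\partial^2\varphi(\hat x^k,\hat v^k)(d^k)$; set $x^{k+1}=\hat x^k+d^k$. Any choices satisfying these requirements are allowed. $Q$-superlinear convergence $x^k\to\bar x$ means $\|x^{k+1}-\bar x\|/\|x^k-\bar x\|\to0$. *)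

theory Defs
  imports "HOL-Analysis.Analysis"
begin

text \<open>
  Extended-real-valued functions have codomain \<^typ>\<open>ereal\<close>; the restriction to
  \<open>(-\<infinity>, \<infinity>]\<close> is part of properness or stated as an explicit condition.
  Pairs carry the Euclidean product norm and inner product.
\<close>

subsection \<open>Normal cones\<close>

text \<open>
  The punctured filter \<open>at z within \<Omega>\<close> is trivial when \<open>z\<close> is isolated in \<open>\<Omega>\<close>; the
  upper limit is then \<open>-\<infinity>\<close>, so the cone is the whole space. Off \<open>\<Omega>\<close> the regular and
  limiting cones are empty.
\<close>

definition regular_normal_cone :: "'a::real_inner set \<Rightarrow> 'a \<Rightarrow> 'a set" where
  "regular_normal_cone \<Omega> z =
     {v. z \<in> \<Omega> \<and>
         Limsup (at z within \<Omega>) (\<lambda>w. ereal ((v \<bullet> (w - z)) / norm (w - z))) \<le> 0}"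

definition limiting_normal_cone :: "'a::real_inner set \<Rightarrow> 'a \<Rightarrow> 'a set" where
  "limiting_normal_cone \<Omega> z =
     {v. z \<in> \<Omega> \<and>
         (\<exists>zs vs. (\<forall>k::nat. zs k \<in> \<Omega> \<and> vs k \<in> regular_normal_cone \<Omega> (zs k)) \<and>
                  zs \<longlonglongrightarrow> z \<and> vs \<longlonglongrightarrow> v)}"

definition directional_normal_cone :: "'a::real_inner set \<Rightarrow> 'a \<Rightarrow> 'a \<Rightarrow> 'a set" where
  "directional_normal_cone \<Omega> z d =
     {v. \<exists>ts ds vs.
           (\<forall>k::nat. ts k > (0::real) \<and> vs k \<in> regular_normal_cone \<Omega> (z + ts k *\<^sub>R ds k)) \<and>
           ts \<longlonglongrightarrow> 0 \<and> ds \<longlonglongrightarrow> d \<and> vs \<longlonglongrightarrow> v}"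

subsection \<open>Coderivatives and properties of set-valued mappings\<close>

definition gph :: "('a \<Rightarrow> 'b set) \<Rightarrow> ('a \<times> 'b) set" where
  "gph F = {(x, y). y \<in> F x}"

definition coderivative ::
  "('a::real_inner \<Rightarrow> 'b::real_inner set) \<Rightarrow> 'a \<Rightarrow> 'b \<Rightarrow> 'b \<Rightarrow> 'a set" where
  "coderivative F x y v = {u. (u, - v) \<in> limiting_normal_cone (gph F) (x, y)}"

definition directional_coderivative ::
  "('a::real_inner \<Rightarrow> 'b::real_inner set) \<Rightarrow> 'a \<times> 'b \<Rightarrow> 'a \<times> 'b \<Rightarrow> 'b \<Rightarrow> 'a set" where
  "directional_coderivative F z d v' =
     {u'. (u', - v') \<in> directional_normal_cone (gph F) z d}"

text \<open>The distance to the empty set is \<open>\<infinity>\<close>, whereas \<^const>\<open>infdist\<close> would give 0.\<close>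

definition edist_set :: "'a::metric_space \<Rightarrow> 'a set \<Rightarrow> ereal" where
  "edist_set x A = (INF a\<in>A. ereal (dist x a))"

definition metrically_regular ::
  "('a::metric_space \<Rightarrow> 'b::metric_space set) \<Rightarrow> 'a \<Rightarrow> 'b \<Rightarrow> bool" where
  "metrically_regular F xbar ybar \<longleftrightarrow>
     (\<exists>\<mu>>0. \<exists>U V. xbar \<in> interior U \<and> ybar \<in> interior V \<and>
        (\<forall>x\<in>U. \<forall>y\<in>V. edist_set x {x'. y \<in> F x'} \<le> ereal \<mu> * edist_set y (F x)))"

definition semismooth_star ::
  "('a::real_inner \<Rightarrow> 'b::real_inner set) \<Rightarrow> 'a \<Rightarrow> 'b \<Rightarrow> bool" where
  "semismooth_star F xbar ybar \<longleftrightarrow>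
     (\<forall>u v u' v'. u' \<in> directional_coderivative F (xbar, ybar) (u, v) v' \<longrightarrow> u' \<bullet> u = v' \<bullet> v)"

subsection \<open>Extended-real-valued functions and subdifferentials\<close>

definition proper_fun :: "('a \<Rightarrow> ereal) \<Rightarrow> bool" where
  "proper_fun \<phi> \<longleftrightarrow> (\<forall>x. \<phi> x \<noteq> -\<infinity>) \<and> (\<exists>x. \<phi> x \<noteq> \<infinity>)"

definition lsc_fun :: "('a::topological_space \<Rightarrow> ereal) \<Rightarrow> bool" where
  "lsc_fun \<phi> \<longleftrightarrow> (\<forall>x. \<phi> x \<le> Liminf (at x) \<phi>)"

definition epi :: "('a \<Rightarrow> ereal) \<Rightarrow> ('a \<times> real) set" where
  "epi \<phi> = {(x, r). \<phi> x \<le> ereal r}"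

text \<open>Only used for functions that avoid \<open>-\<infinity>\<close>, so \<open>\<phi> x\<close> is finite when \<open>\<phi> x < \<infinity>\<close>.\<close>

definition subdiff :: "('a::real_inner \<Rightarrow> ereal) \<Rightarrow> 'a \<Rightarrow> 'a set" where
  "subdiff \<phi> x =
     {v. \<phi> x < \<infinity> \<and> (v, -1) \<in> limiting_normal_cone (epi \<phi>) (x, real_of_ereal (\<phi> x))}"

definition second_subdiff :: "('a::real_inner \<Rightarrow> ereal) \<Rightarrow> 'a \<Rightarrow> 'a \<Rightarrow> 'a \<Rightarrow> 'a set" where
  "second_subdiff \<phi> x v u = coderivative (subdiff \<phi>) x v u"

definition prox_bounded :: "('a::real_inner \<Rightarrow> ereal) \<Rightarrow> bool" where
  "prox_bounded \<phi> \<longleftrightarrow>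
     (\<exists>l>0. \<exists>x. (INF y. \<phi> y + ereal (1 / (2 * l) * (norm (y - x))\<^sup>2)) > -\<infinity>)"

text \<open>Convexity of an extended-real-valued function is convexity of its epigraph.\<close>

definition s_convex :: "real \<Rightarrow> ('a::real_inner \<Rightarrow> ereal) \<Rightarrow> bool" where
  "s_convex s \<psi> \<longleftrightarrow>
     (\<forall>x. \<psi> x \<noteq> -\<infinity>) \<and> convex (epi (\<lambda>x. \<psi> x - ereal (s / 2 * (norm x)\<^sup>2)))"

definition variationally_s_convex ::
  "real \<Rightarrow> ('a::real_inner \<Rightarrow> ereal) \<Rightarrow> 'a \<Rightarrow> 'a \<Rightarrow> bool" where
  "variationally_s_convex s \<phi> xbar vbar \<longleftrightarrow>
     proper_fun \<phi> \<and> lsc_fun \<phi> \<and> vbar \<in> subdiff \<phi> xbar \<and>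
     (\<exists>\<phi>' U V. \<exists>\<epsilon>>0.
        s_convex s \<phi>' \<and>
        convex U \<and> xbar \<in> interior U \<and> convex V \<and> vbar \<in> interior V \<and>
        (\<forall>x\<in>U. \<phi>' x \<le> \<phi> x) \<and>
        (U \<times> V) \<inter> gph (subdiff \<phi>') =
          ({x \<in> U. \<phi> x < \<phi> xbar + ereal \<epsilon>} \<times> V) \<inter> gph (subdiff \<phi>) \<and>
        (\<forall>(x, v) \<in> (U \<times> V) \<inter> gph (subdiff \<phi>'). \<phi>' x = \<phi> x))"

definition prox_regular :: "('a::real_inner \<Rightarrow> ereal) \<Rightarrow> 'a \<Rightarrow> 'a \<Rightarrow> bool" where
  "prox_regular \<phi> xbar vbar \<longleftrightarrow> (\<exists>s\<le>0. variationally_s_convex s \<phi> xbar vbar)"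

definition subdifferentially_continuous ::
  "('a::real_inner \<Rightarrow> ereal) \<Rightarrow> 'a \<Rightarrow> 'a \<Rightarrow> bool" where
  "subdifferentially_continuous \<phi> xbar vbar \<longleftrightarrow>
     (\<forall>\<epsilon>>0. \<exists>\<delta>>0. \<forall>(x, v) \<in> gph (subdiff \<phi>).
        norm (x - xbar) \<le> \<delta> \<and> norm (v - vbar) \<le> \<delta> \<longrightarrow> \<bar>\<phi> x - \<phi> xbar\<bar> < ereal \<epsilon>)"

definition continuously_prox_regular :: "('a::real_inner \<Rightarrow> ereal) \<Rightarrow> 'a \<Rightarrow> 'a \<Rightarrow> bool" where
  "continuously_prox_regular \<phi> xbar vbar \<longleftrightarrow>
     prox_regular \<phi> xbar vbar \<and> subdifferentially_continuous \<phi> xbar vbar"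

subsection \<open>The coderivative-based Newton algorithm\<close>

definition approximate_step ::
  "('a::real_inner \<Rightarrow> ereal) \<Rightarrow> 'a \<Rightarrow> real \<Rightarrow> 'a \<Rightarrow> 'a \<Rightarrow> 'a \<Rightarrow> bool" where
  "approximate_step \<phi> xbar \<eta> x xh vh \<longleftrightarrow>
     (xh, vh) \<in> gph (subdiff \<phi>) \<and> norm ((xh, vh) - (xbar, 0)) \<le> \<eta> * norm (x - xbar)"

definition newton_direction :: "('a::real_inner \<Rightarrow> ereal) \<Rightarrow> 'a \<Rightarrow> 'a \<Rightarrow> 'a \<Rightarrow> bool" where
  "newton_direction \<phi> xh vh d \<longleftrightarrow> - vh \<in> second_subdiff \<phi> xh vh d"

definition newton_iteration ::
  "('a::real_inner \<Rightarrow> ereal) \<Rightarrow> 'a \<Rightarrow> real \<Rightarrow> 'a \<Rightarrow> 'a \<Rightarrow> bool" where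
  "newton_iteration \<phi> xbar \<eta> x x' \<longleftrightarrow>
     0 \<notin> subdiff \<phi> x \<and>
     (\<exists>xh vh d. approximate_step \<phi> xbar \<eta> x xh vh \<and> newton_direction \<phi> xh vh d \<and> x' = xh + d)"

text \<open>
  A run iterates for as long as the stopping test has not succeeded; the entries of the
  sequence after the first iterate with \<open>0 \<in> subdiff \<phi> (X k)\<close> are irrelevant.
\<close>

definition newton_run ::
  "('a::real_inner \<Rightarrow> ereal) \<Rightarrow> 'a \<Rightarrow> real \<Rightarrow> (nat \<Rightarrow> 'a) \<Rightarrow> bool" where
  "newton_run \<phi> xbar \<eta> X \<longleftrightarrow>
     (\<forall>k. (\<forall>j\<le>k. 0 \<notin> subdiff \<phi> (X j)) \<longrightarrow> newton_iteration \<phi> xbar \<eta> (X k) (X (Suc k)))"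

text \<open>
  No execution from \<open>x0\<close> gets stuck: at every iterate reachable in finitely many steps
  that does not pass the stopping test, an approximate step exists, and whichever one is
  taken, a Newton direction exists.
\<close>

definition newton_executable ::
  "('a::real_inner \<Rightarrow> ereal) \<Rightarrow> 'a \<Rightarrow> real \<Rightarrow> 'a \<Rightarrow> bool" where
  "newton_executable \<phi> xbar \<eta> x0 \<longleftrightarrow>
     (\<forall>x. (newton_iteration \<phi> xbar \<eta>)\<^sup>*\<^sup>* x0 x \<and> 0 \<notin> subdiff \<phi> x \<longrightarrow>
        (\<exists>xh vh. approximate_step \<phi> xbar \<eta> x xh vh) \<and>
        (\<forall>xh vh. approximate_step \<phi> xbar \<eta> x xh vh \<longrightarrow> (\<exists>d. newton_direction \<phi> xh vh d)))"

definition Q_superlinear :: "(nat \<Rightarrow> 'a::real_normed_vector) \<Rightarrow> 'a \<Rightarrow> bool" where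
  "Q_superlinear X xbar \<longleftrightarrow>
     X \<longlonglongrightarrow> xbar \<and> (\<lambda>k. norm (X (Suc k) - xbar) / norm (X k - xbar)) \<longlonglongrightarrow> 0"

end

theory Submission
  imports Defs
begin

text \<open>
  Convergence rests on one estimate: if \<open>(xh, vh)\<close> is a graph point of \<open>\<partial>\<phi>\<close> near \<open>(xbar, 0)\<close> and \<open>d\<close> is any
  Newton direction there, then \<open>\<parallel>xh + d - xbar\<parallel> = o(\<parallel>(xh, vh) - (xbar, 0)\<parallel>)\<close>. The approximate step bounds
  the right-hand side by \<open>o(\<parallel>x - xbar\<parallel>)\<close>, so that the algorithm contracts towards \<open>xbar\<close> at a
  superlinear rate (\<open>newton_step_estimate\<close>).

  A Newton direction satisfies only that \<open>(- vh, - d)\<close> is a limiting normal to the graph. For a smooth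
  \<open>\<phi>\<close> with Hessian \<open>H\<close> at \<open>xh\<close> the normals are the pairs \<open>(H y, - y)\<close>, and semismoothness* says that
  \<open>vh = H (xh - xbar)\<close> up to a small error; hence \<open>(vh, - (xh - xbar))\<close> is itself almost a normal, and
  the estimate follows by adding the two normals and applying metric regularity, which bounds the
  second component of a normal by its first (\<open>approximate_normal_bound\<close>). The symmetry of \<open>H\<close> is
  essential: semismoothness* yields \<open>vh = H (xh - xbar)\<close>, while in the normals \<open>H\<close> enters through its
  transpose. In the nonsmooth case the
  graph is parametrised by the proximal map \<open>P\<close> (\<open>prox_regular_chart\<close>), which is Lipschitz and the
  gradient of an envelope. A mean value inequality with proximal subgradients converts
  semismoothness* into an estimate of the increments of \<open>P\<close> in the direction of the offset
  (\<open>increment_along_offset\<close>), and integrating the gradient transposes that estimate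
  (\<open>symmetric_increment\<close>).

  The remaining point is that Newton directions exist, that is, that every \<open>u\<close> occurs as the first
  component of a limiting normal at each graph point near \<open>(xbar, 0)\<close> (\<open>limiting_normal_exists\<close>).
  Normals with nearly this first component are obtained as multipliers in a penalised maximisation
  of \<open>u \<bullet> x\<close> along the graph; the graph has dimension \<open>n\<close>, and so a generic choice of two parameters
  makes an auxiliary level constraint inactive (\<open>regular_normal_near_direction\<close>). Metric regularity
  bounds the second components and permits the passage to the limit.
\<close>

section \<open>Normal cones and set-valued mappings\<close>

lemma regular_normal_cone_iff:
  "v \<in> regular_normal_cone \<Omega> z \<longleftrightarrow>
     z \<in> \<Omega> \<and> (\<forall>e>0. \<exists>\<delta>>0. \<forall>w\<in>\<Omega>. dist w z < \<delta> \<longrightarrow> v \<bullet> (w - z) \<le> e * dist w z)"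
proof (cases "z \<in> \<Omega>")
  case True
  let ?q = "\<lambda>w. (v \<bullet> (w - z)) / norm (w - z)"
  have "v \<in> regular_normal_cone \<Omega> z \<longleftrightarrow> (\<forall>y>0. \<forall>\<^sub>F w in at z within \<Omega>. ereal (?q w) < y)"
    using True by (simp add: regular_normal_cone_def Limsup_le_iff)
  also have "\<dots> \<longleftrightarrow> (\<forall>e>0. \<forall>\<^sub>F w in at z within \<Omega>. ?q w \<le> e)"
  proof (intro iffI allI impI)
    fix e :: real assume *: "\<forall>y>0. \<forall>\<^sub>F w in at z within \<Omega>. ereal (?q w) < y" and "e > 0"
    then have "\<forall>\<^sub>F w in at z within \<Omega>. ereal (?q w) < ereal e" using *[rule_format, of "ereal e"] by simp
    then show "\<forall>\<^sub>F w in at z within \<Omega>. ?q w \<le> e" by (rule eventually_mono) auto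
  next
    fix y :: ereal assume *: "\<forall>e>0. \<forall>\<^sub>F w in at z within \<Omega>. ?q w \<le> e" and "y > 0"
    then obtain e where e: "0 < ereal e" "ereal e < y" using ereal_dense2[of 0 y] by auto
    then have "\<forall>\<^sub>F w in at z within \<Omega>. ?q w \<le> e" using * by auto
    then show "\<forall>\<^sub>F w in at z within \<Omega>. ereal (?q w) < y"
      by (rule eventually_mono) (use e in \<open>meson ereal_less_eq(3) order_le_less_trans\<close>)
  qed
  also have "\<dots> \<longleftrightarrow> (\<forall>e>0. \<exists>\<delta>>0. \<forall>w\<in>\<Omega>. dist w z < \<delta> \<longrightarrow> v \<bullet> (w - z) \<le> e * dist w z)"
  proof -
    have "?q w \<le> e \<longleftrightarrow> v \<bullet> (w - z) \<le> e * dist w z" if "w \<noteq> z" for w and e :: real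
      using that by (simp add: divide_simps dist_norm)
    then have "(w \<noteq> z \<and> dist w z < \<delta> \<longrightarrow> ?q w \<le> e) \<longleftrightarrow>
        (dist w z < \<delta> \<longrightarrow> v \<bullet> (w - z) \<le> e * dist w z)" for w \<delta> e
      by (cases "w = z") auto
    then show ?thesis unfolding eventually_at by presburger
  qed
  finally show ?thesis using True by simp
qed (simp add: regular_normal_cone_def)

lemma proximal_normal_imp_regular:
  assumes "z \<in> \<Omega>" "\<delta> > 0"
    and quad: "\<And>w. w \<in> \<Omega> \<Longrightarrow> dist w z < \<delta> \<Longrightarrow> v \<bullet> (w - z) \<le> K * (dist w z)\<^sup>2"
  shows "v \<in> regular_normal_cone \<Omega> z"
  unfolding regular_normal_cone_iff
proof (intro conjI allI impI)
  fix e :: real assume "e > 0"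
  show "\<exists>\<delta>>0. \<forall>w\<in>\<Omega>. dist w z < \<delta> \<longrightarrow> v \<bullet> (w - z) \<le> e * dist w z"
  proof (intro exI conjI ballI impI)
    show "min \<delta> (e / (\<bar>K\<bar> + 1)) > 0" using \<open>e > 0\<close> assms(2) by auto
  next
    fix w assume w: "w \<in> \<Omega>" "dist w z < min \<delta> (e / (\<bar>K\<bar> + 1))"
    have "v \<bullet> (w - z) \<le> K * (dist w z)\<^sup>2" using quad w by auto
    also have "\<dots> \<le> (\<bar>K\<bar> + 1) * (dist w z)\<^sup>2" by (intro mult_right_mono) auto
    also have "\<dots> = ((\<bar>K\<bar> + 1) * dist w z) * dist w z" by (simp add: power2_eq_square)
    also have "\<dots> \<le> e * dist w z"
      using w by (intro mult_right_mono) (auto simp: pos_less_divide_eq mult.commute intro: less_imp_le)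
    finally show "v \<bullet> (w - z) \<le> e * dist w z" .
  qed
qed (rule assms)

lemma metrically_regular_solve:
  assumes "metrically_regular F xbar ybar"
  obtains \<mu> \<delta> where "\<mu> > 0" "\<delta> > 0"
    "\<And>x y y'. y \<in> F x \<Longrightarrow> dist x xbar < \<delta> \<Longrightarrow> dist y' ybar < \<delta> \<Longrightarrow>
       \<exists>x'. y' \<in> F x' \<and> dist x' x \<le> \<mu> * dist y' y"
proof -
  obtain \<mu> U V where \<mu>: "\<mu> > 0" and U: "xbar \<in> interior U" and V: "ybar \<in> interior V"
    and reg: "\<And>x y. x \<in> U \<Longrightarrow> y \<in> V \<Longrightarrow> edist_set x {x'. y \<in> F x'} \<le> ereal \<mu> * edist_set y (F x)"
    using assms unfolding metrically_regular_def by blast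
  obtain d1 where d1: "d1 > 0" "ball xbar d1 \<subseteq> U" using U by (meson mem_interior)
  obtain d2 where d2: "d2 > 0" "ball ybar d2 \<subseteq> V" using V by (meson mem_interior)
  show thesis
  proof
    show "2 * \<mu> > 0" "min d1 d2 > 0" using \<mu> d1 d2 by auto
    fix x y y' assume y: "y \<in> F x" and x: "dist x xbar < min d1 d2" and y': "dist y' ybar < min d1 d2"
    show "\<exists>x'. y' \<in> F x' \<and> dist x' x \<le> 2 * \<mu> * dist y' y"
    proof (cases "y' = y")
      case True then show ?thesis using y by (intro exI[of _ x]) auto
    next
      case False
      have "x \<in> U" "y' \<in> V" using x y' d1 d2 by (auto simp: subset_iff dist_commute)
      then have "edist_set x {x'. y' \<in> F x'} \<le> ereal \<mu> * edist_set y' (F x)" by (rule reg)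
      also have "\<dots> \<le> ereal \<mu> * ereal (dist y' y)"
        using \<mu> y by (intro ereal_mult_left_mono) (auto simp: edist_set_def intro: INF_lower)
      also have "\<dots> < ereal (2 * \<mu> * dist y' y)" using \<mu> False by simp
      finally obtain x' where "y' \<in> F x'" "ereal (dist x x') < ereal (2 * \<mu> * dist y' y)"
        unfolding edist_set_def INF_less_iff by auto
      then show ?thesis by (auto simp: dist_commute intro!: exI[of _ x'])
    qed
  qed
qed

lemma dist_Pair_le: "dist (x, y) (x', y') \<le> dist x x' + dist y y'"
  by (simp add: dist_Pair_Pair) (metis sqrt_sum_squares_le_sum zero_le_dist)

text \<open>
  Moving the second coordinate in the direction \<open>v\<close> is always possible along \<open>G\<close>, at a cost of
  at most \<open>\<mu>\<close> per unit in the first coordinate. An approximate normal \<open>(u, v)\<close> therefore cannot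
  have a \<open>v\<close> that outweighs \<open>\<mu> u\<close>.
\<close>

lemma approximate_normal_bound:
  fixes u :: "'a::real_inner" and v :: "'b::real_inner"
  assumes "\<mu> > 0" "\<delta> > 0" "e \<ge> 0"
    and solve: "\<And>y'. dist y' y < \<delta> \<Longrightarrow> \<exists>x'. (x', y') \<in> G \<and> dist x' x \<le> \<mu> * dist y' y"
    and nrm: "\<And>z'. z' \<in> G \<Longrightarrow> dist z' (x, y) < \<delta> \<Longrightarrow> (u, v) \<bullet> (z' - (x, y)) \<le> e * dist z' (x, y)"
  shows "norm v \<le> \<mu> * norm u + e * (1 + \<mu>)"
proof (cases "v = 0")
  case True then show ?thesis using assms by simp
next
  case False
  define t where "t = \<delta> / (2 * (1 + \<mu>) * norm v)"
  have t: "t > 0" and tv: "(1 + \<mu>) * (t * norm v) < \<delta>" "t * norm v < \<delta>"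
  proof -
    have p: "norm v > 0" "1 + \<mu> > 0" "2 * (1 + \<mu>) > 0" using False assms by auto
    show "t > 0" unfolding t_def by (intro divide_pos_pos mult_pos_pos p assms)
    have tv: "t * norm v = \<delta> / (2 * (1 + \<mu>))" using p(1) unfolding t_def by simp
    have "s * (\<delta> / (2 * s)) = \<delta> / 2" if "s > 0" for s using that by simp
    then have "(1 + \<mu>) * (t * norm v) = \<delta> / 2" unfolding tv using p(2) by blast
    then show *: "(1 + \<mu>) * (t * norm v) < \<delta>" using assms by simp
    have "1 * (t * norm v) \<le> (1 + \<mu>) * (t * norm v)"
      using p assms \<open>t > 0\<close> by (intro mult_right_mono) auto
    then show "t * norm v < \<delta>" using * by simp
  qed
  define y' where "y' = y + t *\<^sub>R v"
  have dy: "dist y' y = t * norm v" using t by (simp add: y'_def dist_norm)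
  then obtain x' where x': "(x', y') \<in> G" "dist x' x \<le> \<mu> * (t * norm v)" using solve[of y'] tv by auto
  have dz: "dist (x', y') (x, y) \<le> (1 + \<mu>) * (t * norm v)"
    using dist_Pair_le[of x' y' x y] x' dy by (simp add: algebra_simps)
  have "t * (norm v)\<^sup>2 = v \<bullet> (y' - y)" by (simp add: y'_def power2_norm_eq_inner)
  also have "\<dots> = (u, v) \<bullet> ((x', y') - (x, y)) - u \<bullet> (x' - x)" by (simp add: inner_diff_right)
  also have "\<dots> \<le> e * dist (x', y') (x, y) + norm u * dist x' x"
    using nrm[OF x'(1)] dz tv norm_cauchy_schwarz[of "- u" "x' - x"] by (simp add: dist_norm)
  also have "\<dots> \<le> e * ((1 + \<mu>) * (t * norm v)) + norm u * (\<mu> * (t * norm v))"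
    using dz x' assms by (intro add_mono mult_left_mono) auto
  finally have "(t * norm v) * norm v \<le> (t * norm v) * (\<mu> * norm u + e * (1 + \<mu>))"
    by (simp add: algebra_simps power2_eq_square)
  then show ?thesis using t False by (simp add: mult_le_cancel_left)
qed

text \<open>
  Normalising a violating sequence of normals and of base points turns a failure of this uniform
  estimate into a directional limiting normal that violates the defining identity of
  semismoothness*.
\<close>

lemma semismooth_star_uniform:
  fixes F :: "'a::euclidean_space \<Rightarrow> 'b::euclidean_space set"
  assumes ss: "semismooth_star F xbar ybar" and "\<epsilon> > 0"
  shows "\<exists>\<delta>>0. \<forall>z n. dist z (xbar, ybar) < \<delta> \<longrightarrow> n \<in> regular_normal_cone (gph F) z \<longrightarrow>
       \<bar>n \<bullet> (z - (xbar, ybar))\<bar> \<le> \<epsilon> * norm n * dist z (xbar, ybar)"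
proof (rule ccontr)
  let ?zb = "(xbar, ybar)"
  assume neg: "\<not> ?thesis"
  have "\<exists>z n. dist z ?zb < \<delta> \<and> n \<in> regular_normal_cone (gph F) z \<and>
      \<bar>n \<bullet> (z - ?zb)\<bar> > \<epsilon> * norm n * dist z ?zb" if "\<delta> > 0" for \<delta>
    using neg that unfolding not_le[symmetric] by blast
  then have "\<exists>z n. dist z ?zb < 1 / real (Suc k) \<and> n \<in> regular_normal_cone (gph F) z \<and>
      \<bar>n \<bullet> (z - ?zb)\<bar> > \<epsilon> * norm n * dist z ?zb" for k by simp
  then obtain z n where z: "\<And>k. dist (z k) ?zb < 1 / real (Suc k)"
    and n: "\<And>k. n k \<in> regular_normal_cone (gph F) (z k)"
    and viol: "\<And>k. \<bar>n k \<bullet> (z k - ?zb)\<bar> > \<epsilon> * norm (n k) * dist (z k) ?zb" by metis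
  define t where "t k = norm (z k - ?zb)" for k
  define d where "d k = (z k - ?zb) /\<^sub>R t k" for k
  define m where "m k = n k /\<^sub>R norm (n k)" for k
  have t: "t k > 0" for k using viol[of k] by (auto simp: t_def)
  have n0: "norm (n k) > 0" for k using viol[of k] by auto
  have zk: "z k = ?zb + t k *\<^sub>R d k" for k using t[of k] by (simp add: d_def)
  have mreg: "m k \<in> regular_normal_cone (gph F) (z k)" for k
    unfolding regular_normal_cone_iff
  proof (intro conjI allI impI)
    show "z k \<in> gph F" using n by (simp add: regular_normal_cone_iff)
    fix e :: real assume "e > 0"
    then have "e * norm (n k) > 0" using n0 by simp
    then obtain \<delta> where \<delta>: "\<delta> > 0"
      "\<And>w. w\<in>gph F \<Longrightarrow> dist w (z k) < \<delta> \<Longrightarrow> n k \<bullet> (w - z k) \<le> e * norm (n k) * dist w (z k)"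
      using n[of k] unfolding regular_normal_cone_iff by blast
    have "m k \<bullet> (w - z k) \<le> e * dist w (z k)" if "w \<in> gph F" "dist w (z k) < \<delta>" for w
      using \<delta>(2)[OF that] n0[of k] by (simp add: m_def field_simps)
    then show "\<exists>\<delta>>0. \<forall>w\<in>gph F. dist w (z k) < \<delta> \<longrightarrow> m k \<bullet> (w - z k) \<le> e * dist w (z k)"
      using \<delta>(1) by blast
  qed
  have sph: "(d k, m k) \<in> sphere 0 1 \<times> sphere 0 1" for k
    using t[of k] n0[of k] by (auto simp: d_def m_def t_def)
  have cpt: "compact (sphere (0::'a\<times>'b) 1 \<times> sphere (0::'a\<times>'b) 1)" by (intro compact_Times) auto
  obtain l \<sigma> where \<sigma>: "strict_mono (\<sigma>::nat\<Rightarrow>nat)" and lim: "((\<lambda>k. (d k, m k)) \<circ> \<sigma>) \<longlonglongrightarrow> l"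
    using cpt[unfolded compact_def, rule_format, of "\<lambda>k. (d k, m k)"] sph by blast
  obtain d0 m0 where l: "l = (d0, m0)" by (cases l) blast
  have dl: "(\<lambda>k. d (\<sigma> k)) \<longlonglongrightarrow> d0" and ml: "(\<lambda>k. m (\<sigma> k)) \<longlonglongrightarrow> m0"
    using tendsto_fst[OF lim] tendsto_snd[OF lim] by (auto simp: o_def l)
  have "t \<longlonglongrightarrow> 0"
  proof (rule Lim_null_comparison)
    show "(\<lambda>k. 1 / real (Suc k)) \<longlonglongrightarrow> 0" by (rule LIMSEQ_Suc[OF lim_1_over_n])
    show "\<forall>\<^sub>F k in sequentially. norm (t k) \<le> 1 / real (Suc k)"
      using z by (auto simp: t_def dist_norm intro!: always_eventually less_imp_le)
  qed
  then have tl: "(\<lambda>k. t (\<sigma> k)) \<longlonglongrightarrow> 0" using \<sigma> by (rule LIMSEQ_subseq_LIMSEQ[unfolded o_def])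
  have "m0 \<in> directional_normal_cone (gph F) ?zb d0"
    unfolding directional_normal_cone_def mem_Collect_eq
    by (intro exI[of _ "\<lambda>k. t (\<sigma> k)"] exI[of _ "\<lambda>k. d (\<sigma> k)"] exI[of _ "\<lambda>k. m (\<sigma> k)"] conjI allI)
       (use t mreg zk tl dl ml in auto)
  then have "fst m0 \<in> directional_coderivative F ?zb (fst d0, snd d0) (- snd m0)"
    by (simp add: directional_coderivative_def)
  then have "fst m0 \<bullet> fst d0 = - snd m0 \<bullet> snd d0" using ss unfolding semismooth_star_def by blast
  then have "m0 \<bullet> d0 = 0" by (simp add: inner_prod_def)
  moreover have "(\<lambda>k. \<bar>m (\<sigma> k) \<bullet> d (\<sigma> k)\<bar>) \<longlonglongrightarrow> \<bar>m0 \<bullet> d0\<bar>" by (intro tendsto_intros dl ml)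
  moreover have "\<epsilon> \<le> \<bar>m k \<bullet> d k\<bar>" for k
  proof -
    have "m k \<bullet> d k = (n k \<bullet> (z k - ?zb)) / (norm (n k) * t k)"
      unfolding m_def d_def by (simp only: inner_scaleR_left inner_scaleR_right divide_inverse inverse_mult_distrib mult.assoc mult.commute mult.left_commute)
    then have "\<bar>m k \<bullet> d k\<bar> = \<bar>n k \<bullet> (z k - ?zb)\<bar> / (norm (n k) * t k)"
      using n0[of k] t[of k] by (simp add: abs_mult)
    then show ?thesis using viol[of k] n0[of k] t[of k]
      by (simp only: pos_le_divide_eq mult_pos_pos) (simp add: t_def dist_norm mult.assoc)
  qed
  ultimately show False using \<open>\<epsilon> > 0\<close> LIMSEQ_le_const[of _ _ \<epsilon>] by fastforce
qed

section \<open>A proximal mean value inequality\<close>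

definition proximal_subgradient :: "('a::real_inner \<Rightarrow> real) \<Rightarrow> 'a \<Rightarrow> 'a \<Rightarrow> bool" where
  "proximal_subgradient g c \<zeta> \<longleftrightarrow>
     (\<exists>K. \<forall>\<^sub>F c' in nhds c. g c + \<zeta> \<bullet> (c' - c) - K * (norm (c' - c))\<^sup>2 \<le> g c')"

text \<open>
  Minimising \<open>g c - t r' + K \<parallel>c - (a + t (b - a))\<parallel>\<^sup>2\<close> over \<open>c\<close> and \<open>t \<in> [0, 1]\<close>, with
  \<open>r' < g b - g a\<close>, decouples the point from the segment. For large \<open>K\<close> the minimiser has
  \<open>t < 1\<close>; stationarity in \<open>c\<close> makes \<open>2 K (a + t (b - a) - c)\<close> a proximal subgradient, and
  stationarity in \<open>t\<close> says that its inner product with \<open>b - a\<close> is at least \<open>r'\<close>.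
\<close>

lemma proximal_mean_value:
  fixes g :: "'a::euclidean_space \<Rightarrow> real"
  assumes lip: "L-lipschitz_on (ball p \<rho>) g" and a: "a \<in> ball p \<rho>" and b: "b \<in> ball p \<rho>"
    and sub: "\<And>c \<zeta>. c \<in> ball p \<rho> \<Longrightarrow> proximal_subgradient g c \<zeta> \<Longrightarrow> norm \<zeta> \<le> 2 * L \<Longrightarrow>
                \<zeta> \<bullet> (b - a) \<le> r"
  shows "g b - g a \<le> r"
proof (rule ccontr)
  assume "\<not> ?thesis"
  then obtain r' where r': "r < r'" "r' < g b - g a" using dense[of r "g b - g a"] by auto
  have L: "L \<ge> 0" using lip by (rule lipschitz_on_nonneg)
  define \<rho>0 where "\<rho>0 = max (dist a p) (dist b p)"
  obtain \<rho>1 where \<rho>1: "\<rho>0 < \<rho>1" "\<rho>1 < \<rho>"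
    using dense[of \<rho>0 \<rho>] a b by (auto simp: \<rho>0_def dist_commute)
  \<comment> \<open>The second summand of \<open>K\<close> keeps the minimiser off the boundary of \<open>cball p \<rho>1\<close>, the third excludes
    \<open>t = 1\<close>.\<close>
  define K where "K = 1 + L / (\<rho>1 - \<rho>0) + L\<^sup>2 / (g b - g a - r')"
  have K1: "K \<ge> 1" "K > L / (\<rho>1 - \<rho>0)" "K > L\<^sup>2 / (g b - g a - r')"
    using L \<rho>1 r' by (auto simp: K_def add_pos_nonneg add_nonneg_pos)
  have KL: "L / K < \<rho>1 - \<rho>0" "L\<^sup>2 / K < g b - g a - r'"
    using K1 \<rho>1 r' by (auto simp: divide_simps mult.commute)
  define q where "q t = a + t *\<^sub>R (b - a)" for t :: real
  define \<Phi> where "\<Phi> = (\<lambda>(c, t). g c - t * r' + K * (norm (c - q t))\<^sup>2)"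
  have q: "q t \<in> cball p \<rho>0" if "t \<in> {0..1}" for t
  proof -
    have "q t = (1 - t) *\<^sub>R a + t *\<^sub>R b" by (simp add: q_def algebra_simps)
    moreover have "a \<in> cball p \<rho>0" "b \<in> cball p \<rho>0" by (auto simp: \<rho>0_def dist_commute)
    ultimately show ?thesis using convexD[OF convex_cball, of a p \<rho>0 b "1 - t" t] that by auto
  qed
  have sub1: "cball p \<rho>0 \<subseteq> cball p \<rho>1" "cball p \<rho>1 \<subseteq> ball p \<rho>" using \<rho>1 by auto
  have contg: "continuous_on (cball p \<rho>1) g"
    by (rule continuous_on_subset[OF lipschitz_on_continuous_on[OF lip] sub1(2)])
  have "continuous_on (cball p \<rho>1 \<times> {0..1::real}) (\<lambda>x. g (fst x))"
    by (rule continuous_on_compose2[OF contg]) (auto intro: continuous_on_fst continuous_on_id)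
  then have cont: "continuous_on (cball p \<rho>1 \<times> {0..1}) \<Phi>"
    unfolding \<Phi>_def q_def case_prod_beta by (intro continuous_intros)
  have "a \<in> cball p \<rho>1" using \<rho>1 by (auto simp: \<rho>0_def dist_commute)
  then have "(a, 0) \<in> cball p \<rho>1 \<times> {0..1::real}" by simp
  then have "cball p \<rho>1 \<times> {0..1::real} \<noteq> {}" by blast
  then obtain c t where ct: "c \<in> cball p \<rho>1" "t \<in> {0..1}"
    and min: "\<And>c' t'. c' \<in> cball p \<rho>1 \<Longrightarrow> t' \<in> {0..1} \<Longrightarrow> \<Phi> (c, t) \<le> \<Phi> (c', t')"
    using continuous_attains_inf[OF compact_Times[OF compact_cball compact_Icc] _ cont] by blast
  define \<zeta> where "\<zeta> = (2 * K) *\<^sub>R (q t - c)"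
  have lipD: "\<bar>g x - g y\<bar> \<le> L * norm (x - y)" if "x \<in> cball p \<rho>1" "y \<in> cball p \<rho>1" for x y
    using lipschitz_onD[OF lip subsetD[OF sub1(2) that(1)] subsetD[OF sub1(2) that(2)]] by (simp add: dist_norm)
  have "\<Phi> (c, t) \<le> \<Phi> (q t, t)" using min[of "q t" t] q[OF ct(2)] sub1 ct by auto
  then have "K * (norm (c - q t))\<^sup>2 \<le> g (q t) - g c" by (simp add: \<Phi>_def)
  also have "\<dots> \<le> L * norm (c - q t)"
    using lipD[of "q t" c] q[OF ct(2)] sub1 ct by (auto simp: norm_minus_commute)
  finally have "(K * norm (c - q t)) * norm (c - q t) \<le> L * norm (c - q t)"
    by (simp add: power2_eq_square)
  then have cq: "K * norm (c - q t) \<le> L" using L by (cases "c = q t") auto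
  then have cq': "norm (c - q t) \<le> L / K" using K1 by (simp add: field_simps)
  have n\<zeta>: "norm \<zeta> \<le> 2 * L" using cq K1 by (simp add: \<zeta>_def norm_minus_commute)
  have cball: "dist c p < \<rho>1"
    using dist_triangle[of c p "q t"] cq' KL(1) q[OF ct(2)] by (simp add: dist_norm norm_minus_commute)
  have "t \<noteq> 1"
  proof
    assume "t = 1"
    then have qb: "q t = b" by (simp add: q_def)
    have "\<Phi> (c, t) \<le> \<Phi> (a, 0)" using min[of a 0] \<rho>1 by (auto simp: \<rho>0_def dist_commute)
    then have "g c - r' + K * (norm (c - b))\<^sup>2 \<le> g a" using \<open>t = 1\<close> qb by (simp add: \<Phi>_def q_def)
    moreover have "K * (norm (c - b))\<^sup>2 \<ge> 0" using K1 by simp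
    moreover have "g b - g c \<le> L * norm (b - c)" using lipD[of b c] ct \<rho>1 by (auto simp: \<rho>0_def dist_commute)
    moreover have "L * norm (b - c) \<le> L * (L / K)"
      using cq' L qb by (intro mult_left_mono) (auto simp: norm_minus_commute)
    ultimately show False using KL(2) by (simp add: power2_eq_square)
  qed
  then have t1: "t < 1" using ct by auto
  have "proximal_subgradient g c \<zeta>"
    unfolding proximal_subgradient_def
  proof (intro exI[of _ K])
    have "\<forall>\<^sub>F c' in nhds c. c' \<in> ball p \<rho>1"
      using cball by (intro eventually_nhds_in_open) (auto simp: dist_commute)
    then show "\<forall>\<^sub>F c' in nhds c. g c + \<zeta> \<bullet> (c' - c) - K * (norm (c' - c))\<^sup>2 \<le> g c'"
    proof (rule eventually_mono)
      fix c' assume "c' \<in> ball p \<rho>1"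
      then have "\<Phi> (c, t) \<le> \<Phi> (c', t)" using min[of c' t] ct by auto
      then show "g c + \<zeta> \<bullet> (c' - c) - K * (norm (c' - c))\<^sup>2 \<le> g c'"
        by (simp add: \<Phi>_def \<zeta>_def power2_norm_eq_inner algebra_simps inner_commute)
    qed
  qed
  then have "\<zeta> \<bullet> (b - a) \<le> r" using sub[of c \<zeta>] n\<zeta> ct sub1 by auto
  moreover have "r' \<le> \<zeta> \<bullet> (b - a)"
  proof (rule tendsto_le[of "at_right 0" "\<lambda>\<tau>. \<zeta> \<bullet> (b - a) + \<tau> * (K * (norm (b - a))\<^sup>2)" _ "\<lambda>_. r'"])
    have "((\<lambda>\<tau>. \<zeta> \<bullet> (b - a) + \<tau> * (K * (norm (b - a))\<^sup>2)) \<longlongrightarrow> \<zeta> \<bullet> (b - a) + 0 * (K * (norm (b - a))\<^sup>2)) (at_right 0)"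
      by (intro tendsto_intros)
    then show "((\<lambda>\<tau>. \<zeta> \<bullet> (b - a) + \<tau> * (K * (norm (b - a))\<^sup>2)) \<longlongrightarrow> \<zeta> \<bullet> (b - a)) (at_right 0)" by simp
    show "\<forall>\<^sub>F \<tau> in at_right 0. r' \<le> \<zeta> \<bullet> (b - a) + \<tau> * (K * (norm (b - a))\<^sup>2)"
      unfolding eventually_at_right_field
    proof (intro exI[of _ "1 - t"] conjI allI impI)
      fix \<tau> assume \<tau>: "0 < \<tau>" "\<tau> < 1 - t"
      have "\<Phi> (c, t) \<le> \<Phi> (c, t + \<tau>)" using min[of c "t + \<tau>"] ct \<tau> by auto
      have cq1: "c - q (t + \<tau>) = (c - q t) - \<tau> *\<^sub>R (b - a)" by (simp add: q_def algebra_simps)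
      have sq: "(norm (x - \<tau> *\<^sub>R y))\<^sup>2 = (norm x)\<^sup>2 - \<tau> * (2 * (x \<bullet> y)) + \<tau> * (\<tau> * (norm y)\<^sup>2)"
        for x y :: 'a
        by (simp add: power2_norm_eq_inner algebra_simps inner_commute)
      have "K * (norm (c - q (t + \<tau>)))\<^sup>2 = K * ((norm (c - q t))\<^sup>2
          - \<tau> * (2 * ((c - q t) \<bullet> (b - a))) + \<tau> * (\<tau> * (norm (b - a))\<^sup>2))" unfolding cq1 sq ..
      moreover have "g c - t * r' + K * (norm (c - q t))\<^sup>2 \<le> g c - (t + \<tau>) * r' + K * (norm (c - q (t + \<tau>)))\<^sup>2"
        using \<open>\<Phi> (c, t) \<le> \<Phi> (c, t + \<tau>)\<close> by (simp add: \<Phi>_def)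
      ultimately have "\<tau> * r' + K * (norm (c - q t))\<^sup>2 \<le> K * ((norm (c - q t))\<^sup>2
          - \<tau> * (2 * ((c - q t) \<bullet> (b - a))) + \<tau> * (\<tau> * (norm (b - a))\<^sup>2))"
        by (simp only: distrib_right)
      moreover have "\<zeta> \<bullet> (b - a) = - (2 * K) * ((c - q t) \<bullet> (b - a))"
        by (simp add: \<zeta>_def inner_diff_left algebra_simps)
      moreover have "\<tau> * r' \<le> \<tau> * (Z + \<tau> * (K * N))"
        if "\<tau> * r' + K * A \<le> K * (A - \<tau> * (2 * X) + \<tau> * (\<tau> * N))" "Z = - (2 * K) * X"
        for Z A X N :: real
        using that by (simp add: algebra_simps)
      ultimately have "\<tau> * r' \<le> \<tau> * (\<zeta> \<bullet> (b - a) + \<tau> * (K * (norm (b - a))\<^sup>2))"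
        by blast
      then show "r' \<le> \<zeta> \<bullet> (b - a) + \<tau> * (K * (norm (b - a))\<^sup>2)" using \<tau> by simp
    qed (use t1 in simp)
  qed auto
  ultimately show False using r' by simp
qed

section \<open>Graphs with a proximal chart\<close>

text \<open>
  Near \<open>(xbar, 0)\<close> the graph of the subdifferential of a prox-regular function is the image of
  \<open>w \<mapsto> (P w, (w - P w) / lam)\<close>, where the proximal map \<open>P\<close> is Lipschitz and is the gradient of a
  function \<open>\<psi>\<close> (a rescaled Moreau envelope). The inverse of this chart is \<open>(x, v) \<mapsto> x + lam v\<close>.
  The assumption \<open>gradient\<close> stands for the symmetry of second derivatives of \<open>\<psi>\<close>. The last two
  assumptions are metric regularity and the uniform form of semismoothness*.
\<close>

locale semismooth_chart =
  fixes G :: "('a::euclidean_space \<times> 'a) set" and xbar :: 'a and lam r \<delta> \<mu> :: real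
    and P :: "'a \<Rightarrow> 'a" and \<psi> :: "'a \<Rightarrow> real"
  assumes pos: "lam > 0" "r > 0" "\<delta> > 0" "\<mu> > 0"
    and base: "(xbar, 0) \<in> G"
    and chart_mem: "\<And>w. w \<in> ball xbar r \<Longrightarrow> (P w, (w - P w) /\<^sub>R lam) \<in> G"
    and chart_inverse: "\<And>z. z \<in> G \<Longrightarrow> dist z (xbar, 0) < \<delta> \<Longrightarrow> P (fst z + lam *\<^sub>R snd z) = fst z"
    and lipschitz: "2-lipschitz_on (ball xbar r) P"
    and gradient: "\<And>w. w \<in> ball xbar r \<Longrightarrow> (\<psi> has_derivative (\<lambda>h. P w \<bullet> h)) (at w)"
    and solve: "\<And>z y'. z \<in> G \<Longrightarrow> dist z (xbar, 0) < \<delta> \<Longrightarrow> norm y' < \<delta> \<Longrightarrow>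
                  \<exists>x'. (x', y') \<in> G \<and> dist x' (fst z) \<le> \<mu> * dist y' (snd z)"
    and semismooth: "\<And>\<epsilon>. \<epsilon> > 0 \<Longrightarrow> \<exists>\<delta>>0. \<forall>z n. dist z (xbar, 0) < \<delta> \<longrightarrow>
                  n \<in> regular_normal_cone G z \<longrightarrow>
                  \<bar>n \<bullet> (z - (xbar, 0))\<bar> \<le> \<epsilon> * norm n * dist z (xbar, 0)"
begin

abbreviation zbar :: "'a \<times> 'a" where "zbar \<equiv> (xbar, 0)"

definition chart :: "'a \<Rightarrow> 'a \<times> 'a" where "chart w = (P w, (w - P w) /\<^sub>R lam)"

definition param :: "'a \<times> 'a \<Rightarrow> 'a" where "param z = fst z + lam *\<^sub>R snd z"

abbreviation Cp :: real where "Cp \<equiv> 1 + lam"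

abbreviation Cc :: real where "Cc \<equiv> 2 + 3 / lam"

lemma constants_pos: "Cp > 0" "Cc > 0" "0 < 1 + \<mu>"
  using pos by (auto intro: add_pos_pos)

lemma param_chart: "param (chart w) = w"
  using pos by (simp add: param_def chart_def)

lemma chart_param: "z \<in> G \<Longrightarrow> dist z zbar < \<delta> \<Longrightarrow> chart (param z) = z"
  using chart_inverse[of z] pos by (simp add: param_def chart_def prod_eq_iff)

lemma P_param: "z \<in> G \<Longrightarrow> dist z zbar < \<delta> \<Longrightarrow> P (param z) = fst z"
  using chart_inverse[of z] by (simp add: param_def)

lemma param_zbar: "param zbar = xbar"
  by (simp add: param_def)

lemma P_xbar: "P xbar = xbar"
  using P_param[OF base] pos by (simp add: param_zbar)

lemma chart_xbar: "chart xbar = zbar"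
  by (simp add: chart_def P_xbar)

lemma P_lipschitz: "x \<in> ball xbar r \<Longrightarrow> y \<in> ball xbar r \<Longrightarrow> norm (P x - P y) \<le> 2 * norm (x - y)"
  using lipschitz_onD[OF lipschitz] by (simp add: dist_norm)

lemma dist_param_le: "dist (param z) (param z') \<le> Cp * dist z z'"
proof -
  have "dist (param z) (param z') = norm ((fst z - fst z') + lam *\<^sub>R (snd z - snd z'))"
    by (simp add: param_def dist_norm algebra_simps)
  also have "\<dots> \<le> norm (fst z - fst z') + lam * norm (snd z - snd z')"
    using norm_triangle_ineq[of "fst z - fst z'" "lam *\<^sub>R (snd z - snd z')"] pos by simp
  also have "\<dots> \<le> dist z z' + lam * dist z z'"
    using pos dist_fst_le[of z z'] dist_snd_le[of z z'] by (intro add_mono mult_left_mono) (auto simp: dist_norm)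
  finally show ?thesis by (simp add: algebra_simps)
qed

lemma dist_chart_le:
  assumes "x \<in> ball xbar r" "y \<in> ball xbar r"
  shows "dist (chart x) (chart y) \<le> Cc * dist x y"
proof -
  have "dist (chart x) (chart y) \<le> dist (P x) (P y) + dist ((x - P x) /\<^sub>R lam) ((y - P y) /\<^sub>R lam)"
    unfolding chart_def by (rule dist_Pair_le)
  also have "dist ((x - P x) /\<^sub>R lam) ((y - P y) /\<^sub>R lam) = norm ((x - y) - (P x - P y)) / lam"
  proof -
    have "(x - P x) /\<^sub>R lam - (y - P y) /\<^sub>R lam = ((x - y) - (P x - P y)) /\<^sub>R lam" by (simp add: algebra_simps)
    then show ?thesis using pos by (simp add: dist_norm divide_inverse_commute)
  qed
  also have "norm ((x - y) - (P x - P y)) \<le> 3 * norm (x - y)"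
    using norm_triangle_ineq4[of "x - y" "P x - P y"] P_lipschitz[OF assms] by simp
  also have "dist (P x) (P y) \<le> 2 * norm (x - y)" using P_lipschitz[OF assms] by (simp add: dist_norm)
  finally show ?thesis using pos by (simp add: dist_norm divide_simps algebra_simps)
qed

lemma chart_near:
  assumes "x \<in> ball xbar r"
  shows "dist (chart x) zbar \<le> Cc * dist x xbar"
  using dist_chart_le[OF assms, of xbar] pos by (simp add: chart_xbar)

text \<open>
  A proximal subgradient of a scalarisation \<open>q \<bullet> P\<close> is, up to the linear chart inverse, a normal to
  the graph of \<open>P\<close>.
\<close>

lemma proximal_subgradient_imp_normal:
  assumes c: "c \<in> ball xbar r" "dist (chart c) zbar < \<delta>"
    and sub: "proximal_subgradient (\<lambda>w. q \<bullet> P w) c \<zeta>"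
  shows "(\<zeta> - q, lam *\<^sub>R \<zeta>) \<in> regular_normal_cone G (chart c)"
proof -
  obtain K where "\<forall>\<^sub>F c' in nhds c. q \<bullet> P c + \<zeta> \<bullet> (c' - c) - K * (norm (c' - c))\<^sup>2 \<le> q \<bullet> P c'"
    using sub unfolding proximal_subgradient_def by blast
  then obtain \<rho> where \<rho>: "\<rho> > 0"
    and K: "\<And>c'. dist c' c < \<rho> \<Longrightarrow> q \<bullet> P c + \<zeta> \<bullet> (c' - c) - K * (norm (c' - c))\<^sup>2 \<le> q \<bullet> P c'"
    unfolding eventually_nhds_metric by blast
  show ?thesis
  proof (rule proximal_normal_imp_regular)
    show "chart c \<in> G" using chart_mem[OF c(1)] by (simp add: chart_def)
    show "min (\<delta> - dist (chart c) zbar) (\<rho> / Cp) > 0" using c \<rho> constants_pos by simp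
    fix w assume w: "w \<in> G" "dist w (chart c) < min (\<delta> - dist (chart c) zbar) (\<rho> / Cp)"
    define c' where "c' = param w"
    have "dist w zbar < \<delta>" using dist_triangle[of w zbar "chart c"] w by simp
    then have Pc': "P c' = fst w" unfolding c'_def by (rule P_param[OF w(1)])
    have dc: "dist c' c \<le> Cp * dist w (chart c)"
      using dist_param_le[of w "chart c"] by (simp add: c'_def param_chart)
    also have "Cp * dist w (chart c) < \<rho>" using w constants_pos by (simp add: field_simps)
    finally have "\<zeta> \<bullet> (c' - c) - q \<bullet> (P c' - P c) \<le> K * (norm (c' - c))\<^sup>2"
      using K[of c'] by (simp add: inner_diff_right)
    moreover have "(\<zeta> - q, lam *\<^sub>R \<zeta>) \<bullet> (w - chart c) = \<zeta> \<bullet> (c' - c) - q \<bullet> (P c' - P c)"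
    proof -
      define X where "X = snd w - (c - P c) /\<^sub>R lam"
      have "lam *\<^sub>R X = (c' - c) - (fst w - P c)"
        using pos by (simp add: X_def c'_def param_def algebra_simps)
      moreover have "(\<zeta> - q, lam *\<^sub>R \<zeta>) \<bullet> (w - chart c) = (\<zeta> - q) \<bullet> (fst w - P c) + \<zeta> \<bullet> (lam *\<^sub>R X)"
        by (simp add: chart_def inner_prod_def X_def)
      ultimately show ?thesis by (simp add: Pc' inner_diff_left inner_diff_right)
    qed
    moreover have "K * (norm (c' - c))\<^sup>2 \<le> \<bar>K\<bar> * (Cp * dist w (chart c))\<^sup>2"
      using dc by (intro mult_mono power_mono) (auto simp: dist_norm)
    ultimately show "(\<zeta> - q, lam *\<^sub>R \<zeta>) \<bullet> (w - chart c) \<le> (\<bar>K\<bar> * Cp\<^sup>2) * (dist w (chart c))\<^sup>2"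
      by (simp add: power_mult_distrib mult.assoc)
  qed
qed

text \<open>
  Semismoothness* says that the (generalised) derivative of \<open>P\<close> at points near \<open>xbar\<close> maps the offset
  \<open>w - xbar\<close> to \<open>P w - xbar\<close> up to a small relative error. The proximal mean value inequality turns
  this into an estimate for increments of the merely Lipschitz map \<open>P\<close> in the direction of the
  offset.
\<close>

lemma increment_along_offset:
  assumes "e > 0"
  shows "\<exists>\<eta>>0. \<forall>wh. wh \<noteq> xbar \<longrightarrow> dist wh xbar < \<eta> \<longrightarrow>
    (\<exists>\<rho>>0. \<forall>a\<in>ball wh \<rho>. \<forall>b\<in>ball wh \<rho>. \<forall>s>0. b - a = s *\<^sub>R (wh - xbar) \<longrightarrow>
       norm (P b - P a - s *\<^sub>R (P wh - xbar)) \<le> s * (e * dist wh xbar))"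
proof -
  \<comment> \<open>\<open>5 + 4 * lam\<close> bounds the normal relative to \<open>q\<close>, \<open>2 * Cc\<close> its base point relative to the offset;
    the summand 6 is the cost of replacing the base point by \<open>wh\<close>.\<close>
  define C where "C = 2 * Cc * (5 + 4 * lam) + 6"
  have "2 * Cc * (5 + 4 * lam) > 0" using constants_pos pos by (intro mult_pos_pos) auto
  then have C: "C > 0" by (simp add: C_def)
  define e' where "e' = min 1 (e / C)"
  have e': "e' > 0" "e' \<le> 1" "e' * C \<le> e" using C assms by (auto simp: e'_def min_def field_simps)
  obtain \<delta>s where \<delta>s: "\<delta>s > 0"
    and ss: "\<And>z n. dist z zbar < \<delta>s \<Longrightarrow> n \<in> regular_normal_cone G z \<Longrightarrow>
                \<bar>n \<bullet> (z - zbar)\<bar> \<le> e' * norm n * dist z zbar"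
    using semismooth[OF e'(1)] by blast
  define \<eta> where "\<eta> = min (r / 2) (min \<delta> \<delta>s / (2 * Cc))"
  have \<eta>: "\<eta> > 0" "2 * \<eta> \<le> r"
    using pos \<delta>s constants_pos by (auto simp: \<eta>_def)
  have \<eta>': "Cc * (2 * \<eta>) \<le> min \<delta> \<delta>s"
  proof -
    have "\<eta> \<le> min \<delta> \<delta>s / (2 * Cc)" by (simp add: \<eta>_def)
    then have "\<eta> * (2 * Cc) \<le> min \<delta> \<delta>s" using constants_pos by (subst (asm) pos_le_divide_eq) auto
    then show ?thesis by (simp only: mult.commute mult.left_commute mult.assoc)
  qed
  have "\<exists>\<rho>>0. \<forall>a\<in>ball wh \<rho>. \<forall>b\<in>ball wh \<rho>. \<forall>s>0. b - a = s *\<^sub>R (wh - xbar) \<longrightarrow>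
       norm (P b - P a - s *\<^sub>R (P wh - xbar)) \<le> s * (e * dist wh xbar)"
    if wh: "wh \<noteq> xbar" "dist wh xbar < \<eta>" for wh
  proof -
    define D where "D = dist wh xbar"
    have D: "D > 0" "D < \<eta>" using wh by (auto simp: D_def)
    define \<rho> where "\<rho> = e' * D"
    have \<rho>: "\<rho> > 0" "\<rho> \<le> D" using e' D by (auto simp: \<rho>_def mult_left_le_one_le)
    have near: "dist c xbar < 2 * D" "c \<in> ball xbar r" if "c \<in> ball wh \<rho>" for c
      using dist_triangle[of c xbar wh] that \<rho> D \<eta> by (auto simp: D_def dist_commute)
    have wh_in: "wh \<in> ball wh \<rho>" using \<rho> by simp
    have "norm (P b - P a - s *\<^sub>R (P wh - xbar)) \<le> s * (e * D)"
      if ab: "a \<in> ball wh \<rho>" "b \<in> ball wh \<rho>" "s > 0" "b - a = s *\<^sub>R (wh - xbar)" for a b s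
    proof -
      define \<kappa> where "\<kappa> = P wh - xbar"
      \<comment> \<open>The error itself serves as the scalarising vector; its squared norm is then the quantity
        controlled by the mean value inequality.\<close>
      define q where "q = P b - P a - s *\<^sub>R \<kappa>"
      have "q \<bullet> P b - q \<bullet> P a \<le> s * (q \<bullet> \<kappa> + e * D * norm q)"
      proof (rule proximal_mean_value[of "2 * norm q" wh \<rho> "\<lambda>w. q \<bullet> P w"])
        show "(2 * norm q)-lipschitz_on (ball wh \<rho>) (\<lambda>w. q \<bullet> P w)"
        proof (rule lipschitz_onI)
          fix x y assume "x \<in> ball wh \<rho>" "y \<in> ball wh \<rho>"
          then have "norm q * norm (P x - P y) \<le> norm q * (2 * norm (x - y))"
            by (intro mult_left_mono P_lipschitz near) auto
          then show "dist (q \<bullet> P x) (q \<bullet> P y) \<le> 2 * norm q * dist x y"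
            using Cauchy_Schwarz_ineq2[of q "P x - P y"] by (simp add: dist_norm inner_diff_right)
        qed simp
      next
        fix c \<zeta> assume c: "c \<in> ball wh \<rho>" and sub: "proximal_subgradient (\<lambda>w. q \<bullet> P w) c \<zeta>"
          and "norm \<zeta> \<le> 2 * (2 * norm q)"
        then have n\<zeta>: "norm \<zeta> \<le> 4 * norm q" by simp
        have "dist (chart c) zbar \<le> Cc * dist c xbar" using near(2)[OF c] by (rule chart_near)
        also have "\<dots> \<le> Cc * (2 * D)" using near(1)[OF c] constants_pos by (intro mult_left_mono) auto
        finally have dcc: "dist (chart c) zbar \<le> Cc * (2 * D)" .
        also have "\<dots> < Cc * (2 * \<eta>)" using D constants_pos by (intro mult_strict_left_mono) auto
        finally have small: "dist (chart c) zbar < min \<delta> \<delta>s" using \<eta>' by linarith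
        define n where "n = (\<zeta> - q, lam *\<^sub>R \<zeta>)"
        have nN: "n \<in> regular_normal_cone G (chart c)"
          unfolding n_def using near(2)[OF c] small sub by (intro proximal_subgradient_imp_normal) auto
        have "norm n \<le> norm (\<zeta> - q) + lam * norm \<zeta>"
          using norm_Pair_le[of "\<zeta> - q" "lam *\<^sub>R \<zeta>"] pos by (simp add: n_def)
        also have "\<dots> \<le> (4 * norm q + norm q) + lam * (4 * norm q)"
          using norm_triangle_ineq4[of \<zeta> q] n\<zeta> pos by (intro add_mono mult_left_mono) auto
        finally have nn: "norm n \<le> (5 + 4 * lam) * norm q" by (simp add: algebra_simps)
        have "n \<bullet> (chart c - zbar) = \<zeta> \<bullet> (c - xbar) - q \<bullet> (P c - xbar)"
        proof -
          have "lam *\<^sub>R ((c - P c) /\<^sub>R lam) = c - P c" using pos by simp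
          then have "(lam *\<^sub>R \<zeta>) \<bullet> ((c - P c) /\<^sub>R lam) = \<zeta> \<bullet> (c - P c)" using pos by simp
          then have "n \<bullet> (chart c - zbar) = (\<zeta> - q) \<bullet> (P c - xbar) + \<zeta> \<bullet> (c - P c)"
            unfolding n_def chart_def inner_prod_def by simp
          then show ?thesis by (simp add: inner_diff_left inner_diff_right)
        qed
        moreover have "\<bar>n \<bullet> (chart c - zbar)\<bar> \<le> e' * norm n * dist (chart c) zbar"
          using ss nN small by auto
        moreover have "e' * norm n * dist (chart c) zbar \<le> e' * ((5 + 4 * lam) * norm q) * (Cc * (2 * D))"
          using e' nn dcc pos D by (intro mult_mono) auto
        ultimately have 1: "\<zeta> \<bullet> (c - xbar) \<le> q \<bullet> (P c - xbar) + e' * ((5 + 4 * lam) * norm q) * (Cc * (2 * D))"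
          by linarith
        have dcw: "norm (wh - c) \<le> \<rho>" "norm (c - wh) \<le> \<rho>"
          using c by (auto simp: dist_norm norm_minus_commute)
        have "\<zeta> \<bullet> (wh - c) \<le> norm \<zeta> * norm (wh - c)" by (rule norm_cauchy_schwarz)
        also have "\<dots> \<le> (4 * norm q) * \<rho>" using n\<zeta> dcw by (intro mult_mono) auto
        finally have 2: "\<zeta> \<bullet> (wh - c) \<le> 4 * norm q * \<rho>" .
        have "q \<bullet> (P c - P wh) \<le> norm q * norm (P c - P wh)" by (rule norm_cauchy_schwarz)
        also have "\<dots> \<le> norm q * (2 * \<rho>)"
          using P_lipschitz[OF near(2)[OF c] near(2)[OF wh_in]] dcw by (intro mult_left_mono) auto
        finally have 3: "q \<bullet> (P c - P wh) \<le> norm q * (2 * \<rho>)" .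
        have "\<zeta> \<bullet> (wh - xbar) \<le> q \<bullet> \<kappa> + (e' * C) * (D * norm q)"
        proof -
          have "\<zeta> \<bullet> (wh - xbar) = \<zeta> \<bullet> (c - xbar) + \<zeta> \<bullet> (wh - c)" by (simp add: inner_diff_right)
          moreover have "q \<bullet> \<kappa> = q \<bullet> (P c - xbar) - q \<bullet> (P c - P wh)"
            by (simp add: \<kappa>_def inner_diff_right)
          moreover have "(e' * C) * (D * norm q) =
              e' * ((5 + 4 * lam) * norm q) * (Cc * (2 * D)) + 4 * norm q * \<rho> + norm q * (2 * \<rho>)"
            unfolding C_def \<rho>_def by (simp only: ring_distribs) (simp add: mult_ac)
          ultimately show ?thesis using 1 2 3 by linarith
        qed
        also have "(e' * C) * (D * norm q) \<le> e * (D * norm q)" using e' D by (intro mult_right_mono) auto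
        finally have "s * (\<zeta> \<bullet> (wh - xbar)) \<le> s * (q \<bullet> \<kappa> + e * D * norm q)"
          using \<open>s > 0\<close> by (simp add: mult.assoc)
        then show "\<zeta> \<bullet> (b - a) \<le> s * (q \<bullet> \<kappa> + e * D * norm q)" using ab(4) by simp
      qed (use ab in auto)
      moreover have "norm q * norm q = q \<bullet> P b - q \<bullet> P a - s * (q \<bullet> \<kappa>)"
        unfolding power2_eq_square[symmetric] power2_norm_eq_inner
        by (subst (2) q_def) (simp add: inner_diff_right)
      ultimately have "norm q * norm q \<le> norm q * (s * (e * D))" by (simp add: algebra_simps)
      moreover have "s * (e * D) \<ge> 0" using \<open>s > 0\<close> assms D by simp
      ultimately have "norm q \<le> s * (e * D)"
        by (cases "norm q = 0") (auto simp: mult_le_cancel_left)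
      then show ?thesis by (simp add: q_def \<kappa>_def)
    qed
    then show ?thesis using \<rho>(1) unfolding D_def by blast
  qed
  then show ?thesis using \<eta>(1) by blast
qed

text \<open>
  For twice differentiable \<open>\<psi>\<close> this estimate would follow from the previous one because the derivative
  of \<open>P = grad \<psi>\<close> is symmetric. In general the symmetry is used in integrated form: the function
  \<open>w \<mapsto> \<psi> (w + s (wh - xbar)) - \<psi> w\<close> has the gradient \<open>P (w + s (wh - xbar)) - P w\<close>, and its
  difference quotients in \<open>s\<close> tend to \<open>P w \<bullet> (wh - xbar)\<close>.
\<close>

lemma symmetric_increment:
  assumes "e > 0"
  shows "\<exists>\<eta>>0. \<forall>wh. dist wh xbar < \<eta> \<longrightarrow>
    (\<exists>\<rho>>0. \<forall>x\<in>ball wh \<rho>. \<forall>y\<in>ball wh \<rho>.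
       \<bar>(wh - xbar) \<bullet> (P x - P y) - (P wh - xbar) \<bullet> (x - y)\<bar> \<le> e * dist wh xbar * norm (x - y))"
proof -
  obtain \<eta>0 where \<eta>0: "\<eta>0 > 0" and inc: "\<And>wh. wh \<noteq> xbar \<Longrightarrow> dist wh xbar < \<eta>0 \<Longrightarrow>
    (\<exists>\<rho>>0. \<forall>a\<in>ball wh \<rho>. \<forall>b\<in>ball wh \<rho>. \<forall>s>0. b - a = s *\<^sub>R (wh - xbar) \<longrightarrow>
       norm (P b - P a - s *\<^sub>R (P wh - xbar)) \<le> s * (e * dist wh xbar))"
    using increment_along_offset[OF assms] by blast
  have "\<exists>\<rho>>0. \<forall>x\<in>ball wh \<rho>. \<forall>y\<in>ball wh \<rho>.
       \<bar>(wh - xbar) \<bullet> (P x - P y) - (P wh - xbar) \<bullet> (x - y)\<bar> \<le> e * dist wh xbar * norm (x - y)"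
    if wh: "dist wh xbar < min \<eta>0 (r / 2)" for wh
  proof (cases "wh = xbar")
    case True
    then show ?thesis by (intro exI[of _ 1]) (simp add: P_xbar)
  next
    case False
    define y0 where "y0 = wh - xbar"
    define \<kappa> where "\<kappa> = P wh - xbar"
    have y0: "norm y0 > 0" using False by (simp add: y0_def)
    obtain \<rho>0 where \<rho>0: "\<rho>0 > 0" and inc': "\<And>a b s. a\<in>ball wh \<rho>0 \<Longrightarrow> b\<in>ball wh \<rho>0 \<Longrightarrow> s > 0 \<Longrightarrow>
        b - a = s *\<^sub>R y0 \<Longrightarrow> norm (P b - P a - s *\<^sub>R \<kappa>) \<le> s * (e * norm y0)"
      using inc[OF False] wh unfolding y0_def \<kappa>_def dist_norm by auto
    define \<rho> where "\<rho> = min \<rho>0 (r / 2) / 2"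
    have \<rho>: "\<rho> > 0" "2 * \<rho> \<le> \<rho>0" "2 * \<rho> \<le> r / 2" using \<rho>0 pos by (auto simp: \<rho>_def)
    have big: "w \<in> ball wh \<rho>0" "w \<in> ball xbar r" if "dist w wh < 2 * \<rho>" for w
      using that \<rho> wh dist_triangle[of w xbar wh] by (auto simp: dist_commute)
    have bound: "\<bar>((\<psi> (x + s *\<^sub>R y0) - \<psi> x) / s - (\<psi> (y + s *\<^sub>R y0) - \<psi> y) / s) - \<kappa> \<bullet> (x - y)\<bar>
        \<le> e * norm y0 * norm (x - y)"
      if s: "0 < s" "s * norm y0 < \<rho>" and xy: "x \<in> ball wh \<rho>" "y \<in> ball wh \<rho>" for s x y
    proof -
      define h where "h = (\<lambda>w. \<psi> (w + s *\<^sub>R y0) - \<psi> w - s * (\<kappa> \<bullet> w))"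
      have near: "dist w wh < 2 * \<rho>" "dist (w + s *\<^sub>R y0) wh < 2 * \<rho>" if "w \<in> ball wh \<rho>" for w
      proof -
        show "dist w wh < 2 * \<rho>" using that \<rho> by (simp add: dist_commute)
        have "dist (w + s *\<^sub>R y0) w < \<rho>" using s by (simp add: dist_norm)
        then show "dist (w + s *\<^sub>R y0) wh < 2 * \<rho>"
          using dist_triangle[of "w + s *\<^sub>R y0" wh w] that by (simp add: dist_commute)
      qed
      have "norm (h x - h y) \<le> (s * (e * norm y0)) * norm (x - y)"
      proof (rule differentiable_bound[OF convex_ball _ _ xy])
        fix w assume w: "w \<in> ball wh \<rho>"
        have d1: "(\<psi> has_derivative (\<lambda>h. P (w + s *\<^sub>R y0) \<bullet> h)) (at (w + s *\<^sub>R y0))"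
          by (intro gradient big near w)
        have "((\<lambda>w. \<psi> (w + s *\<^sub>R y0)) has_derivative (\<lambda>h. P (w + s *\<^sub>R y0) \<bullet> h)) (at w)"
          by (rule has_derivative_compose[of "\<lambda>w. w + s *\<^sub>R y0" "\<lambda>h. h" w UNIV \<psi>, OF _ d1])
             (auto intro!: derivative_eq_intros)
        moreover have "(\<psi> has_derivative (\<lambda>h. P w \<bullet> h)) (at w)" by (intro gradient big near w)
        moreover have "((\<lambda>w. s * (\<kappa> \<bullet> w)) has_derivative (\<lambda>h. s * (\<kappa> \<bullet> h))) (at w)"
          by (auto intro!: derivative_eq_intros)
        ultimately have "(h has_derivative
            (\<lambda>h. P (w + s *\<^sub>R y0) \<bullet> h - P w \<bullet> h - s * (\<kappa> \<bullet> h))) (at w)"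
          unfolding h_def by (intro has_derivative_diff)
        then show "(h has_derivative (\<lambda>h. (P (w + s *\<^sub>R y0) - P w - s *\<^sub>R \<kappa>) \<bullet> h)) (at w within ball wh \<rho>)"
          by (rule has_derivative_at_withinI[OF has_derivative_eq_rhs]) (simp add: fun_eq_iff inner_diff_left)
        have "norm (P (w + s *\<^sub>R y0) - P w - s *\<^sub>R \<kappa>) \<le> s * (e * norm y0)"
          using s by (intro inc' big near w) auto
        then show "onorm (\<lambda>h. (P (w + s *\<^sub>R y0) - P w - s *\<^sub>R \<kappa>) \<bullet> h) \<le> s * (e * norm y0)"
          by (intro onorm_le order_trans[OF Cauchy_Schwarz_ineq2[folded real_norm_def]] mult_right_mono) auto
      qed
      moreover have "h x - h y = s * (((\<psi> (x + s *\<^sub>R y0) - \<psi> x) / s - (\<psi> (y + s *\<^sub>R y0) - \<psi> y) / s)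
          - \<kappa> \<bullet> (x - y))"
        using s by (simp add: h_def field_simps inner_diff_right)
      ultimately have "s * \<bar>((\<psi> (x + s *\<^sub>R y0) - \<psi> x) / s - (\<psi> (y + s *\<^sub>R y0) - \<psi> y) / s) - \<kappa> \<bullet> (x - y)\<bar>
          \<le> s * (e * norm y0 * norm (x - y))"
        using s by (simp add: abs_mult mult.assoc)
      then show ?thesis using s by simp
    qed
    have lim: "((\<lambda>s. (\<psi> (w + s *\<^sub>R y0) - \<psi> w) / s) \<longlongrightarrow> P w \<bullet> y0) (at_right 0)"
      if "w \<in> ball wh \<rho>" for w
    proof -
      have "(\<psi> has_derivative (\<lambda>h. P w \<bullet> h)) (at (w + 0 *\<^sub>R y0))"
        using gradient[OF big(2)[of w]] that \<rho> by (simp add: dist_commute)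
      then have "((\<lambda>s. \<psi> (w + s *\<^sub>R y0)) has_derivative (\<lambda>s. P w \<bullet> (s *\<^sub>R y0))) (at 0)"
        by (rule has_derivative_compose[rotated]) (auto intro!: derivative_eq_intros)
      then have "((\<lambda>s. \<psi> (w + s *\<^sub>R y0)) has_real_derivative P w \<bullet> y0) (at 0)"
        by (simp add: has_field_derivative_def mult.commute[of _ "P w \<bullet> y0"] mult_commute_abs)
      then have "((\<lambda>s. (\<psi> (w + s *\<^sub>R y0) - \<psi> w) / s) \<longlongrightarrow> P w \<bullet> y0) (at 0)"
        unfolding DERIV_def by simp
      then show ?thesis by (rule tendsto_mono[rotated]) (rule at_le, simp)
    qed
    have "\<bar>y0 \<bullet> (P x - P y) - \<kappa> \<bullet> (x - y)\<bar> \<le> e * norm y0 * norm (x - y)"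
      if xy: "x \<in> ball wh \<rho>" "y \<in> ball wh \<rho>" for x y
    proof -
      have "((\<lambda>s. \<bar>((\<psi> (x + s *\<^sub>R y0) - \<psi> x) / s - (\<psi> (y + s *\<^sub>R y0) - \<psi> y) / s) - \<kappa> \<bullet> (x - y)\<bar>)
          \<longlongrightarrow> \<bar>(P x \<bullet> y0 - P y \<bullet> y0) - \<kappa> \<bullet> (x - y)\<bar>) (at_right 0)"
        by (intro tendsto_intros lim xy)
      moreover have "\<forall>\<^sub>F s in at_right 0.
          \<bar>((\<psi> (x + s *\<^sub>R y0) - \<psi> x) / s - (\<psi> (y + s *\<^sub>R y0) - \<psi> y) / s) - \<kappa> \<bullet> (x - y)\<bar>
            \<le> e * norm y0 * norm (x - y)"
        unfolding eventually_at_right_field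
      proof (intro exI[of _ "\<rho> / norm y0"] conjI allI impI)
        fix s assume "0 < s" "s < \<rho> / norm y0"
        then show "\<bar>((\<psi> (x + s *\<^sub>R y0) - \<psi> x) / s - (\<psi> (y + s *\<^sub>R y0) - \<psi> y) / s) - \<kappa> \<bullet> (x - y)\<bar>
            \<le> e * norm y0 * norm (x - y)"
          using y0 by (intro bound xy) (simp_all add: pos_less_divide_eq)
      qed (use \<rho> y0 in simp)
      ultimately have "\<bar>(P x \<bullet> y0 - P y \<bullet> y0) - \<kappa> \<bullet> (x - y)\<bar> \<le> e * norm y0 * norm (x - y)"
        by (rule tendsto_upperbound) simp
      then show ?thesis by (simp add: inner_commute inner_diff_right inner_diff_left)
    qed
    then show ?thesis using \<rho>(1) unfolding y0_def \<kappa>_def dist_norm by blast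
  qed
  then show ?thesis using \<eta>0 pos by (intro exI[of _ "min \<eta>0 (r / 2)"]) auto
qed

end

section \<open>Newton steps at graph points\<close>

context semismooth_chart
begin

lemma symmetric_increment_on_graph:
  assumes "e > 0"
  shows "\<exists>\<eta>>0. \<forall>xh vh. (xh, vh) \<in> G \<longrightarrow> dist (xh, vh) zbar < \<eta> \<longrightarrow>
    (\<exists>\<sigma>>0. \<forall>z\<in>G. \<forall>z'\<in>G. dist z (xh, vh) < \<sigma> \<longrightarrow> dist z' (xh, vh) < \<sigma> \<longrightarrow>
       (vh, xbar - xh) \<bullet> (z' - z) \<le> e * dist (xh, vh) zbar * dist z' z)"
proof -
  define e0 where "e0 = e * lam / (Cp * Cp)"
  have e0: "e0 > 0" "e0 * (Cp * Cp) = lam * e" using assms pos constants_pos by (auto simp: e0_def)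
  obtain \<eta>0 where \<eta>0: "\<eta>0 > 0" and sym: "\<And>wh. dist wh xbar < \<eta>0 \<Longrightarrow>
    \<exists>\<rho>>0. \<forall>x\<in>ball wh \<rho>. \<forall>y\<in>ball wh \<rho>.
       \<bar>(wh - xbar) \<bullet> (P x - P y) - (P wh - xbar) \<bullet> (x - y)\<bar> \<le> e0 * dist wh xbar * norm (x - y)"
    using symmetric_increment[OF e0(1)] by blast
  have "\<exists>\<sigma>>0. \<forall>z\<in>G. \<forall>z'\<in>G. dist z (xh, vh) < \<sigma> \<longrightarrow> dist z' (xh, vh) < \<sigma> \<longrightarrow>
       (vh, xbar - xh) \<bullet> (z' - z) \<le> e * dist (xh, vh) zbar * dist z' z"
    if zh: "(xh, vh) \<in> G" "dist (xh, vh) zbar < min \<delta> (\<eta>0 / Cp)" for xh vh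
  proof -
    define wh where "wh = param (xh, vh)"
    have Pwh: "P wh = xh" using P_param[OF zh(1)] zh(2) by (simp add: wh_def)
    have dwh: "dist wh xbar \<le> Cp * dist (xh, vh) zbar"
      using dist_param_le[of "(xh, vh)" zbar] by (simp add: wh_def param_zbar)
    also have "\<dots> < \<eta>0" using zh(2) constants_pos by (simp add: pos_less_divide_eq mult.commute)
    finally obtain \<rho> where \<rho>: "\<rho> > 0" and sym': "\<And>x y. x\<in>ball wh \<rho> \<Longrightarrow> y\<in>ball wh \<rho> \<Longrightarrow>
       \<bar>(wh - xbar) \<bullet> (P x - P y) - (P wh - xbar) \<bullet> (x - y)\<bar> \<le> e0 * dist wh xbar * norm (x - y)"
      using sym by blast
    define \<sigma> where "\<sigma> = min (\<delta> - dist (xh, vh) zbar) (\<rho> / Cp)"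
    have \<sigma>: "\<sigma> > 0" using zh \<rho> constants_pos by (simp add: \<sigma>_def)
    have "(vh, xbar - xh) \<bullet> (z' - z) \<le> e * dist (xh, vh) zbar * dist z' z"
      if z: "z \<in> G" "z' \<in> G" "dist z (xh, vh) < \<sigma>" "dist z' (xh, vh) < \<sigma>" for z z'
    proof -
      have fine: "P (param z) = fst z" "param z \<in> ball wh \<rho>" if "z \<in> G" "dist z (xh, vh) < \<sigma>" for z
      proof -
        have "dist z zbar < \<delta>" using dist_triangle[of z zbar "(xh, vh)"] that by (simp add: \<sigma>_def)
        then show "P (param z) = fst z" using that P_param by blast
        have "dist (param z) wh \<le> Cp * dist z (xh, vh)" by (simp add: wh_def dist_param_le)
        also have "\<dots> < \<rho>" using that constants_pos by (simp add: \<sigma>_def pos_less_divide_eq mult.commute)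
        finally show "param z \<in> ball wh \<rho>" by (simp add: dist_commute)
      qed
      note zf = fine[OF z(1,3)] fine[OF z(2,4)]
      have "lam * ((vh, xbar - xh) \<bullet> (z' - z)) =
          (wh - xbar) \<bullet> (P (param z') - P (param z)) - (P wh - xbar) \<bullet> (param z' - param z)"
        unfolding zf Pwh
        by (simp add: wh_def param_def inner_prod_def inner_diff_left inner_diff_right inner_add_left
            inner_add_right algebra_simps)
      also have "\<dots> \<le> e0 * dist wh xbar * norm (param z' - param z)"
        using sym'[OF zf(4,2)] by linarith
      also have "\<dots> \<le> e0 * (Cp * dist (xh, vh) zbar) * (Cp * dist z' z)"
        using dwh dist_param_le[of z' z] e0 constants_pos
        by (intro mult_mono mult_left_mono) (auto simp: dist_norm)
      also have "\<dots> = (e0 * (Cp * Cp)) * (dist (xh, vh) zbar * dist z' z)" by (simp only: mult_ac)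
      also have "\<dots> = lam * (e * dist (xh, vh) zbar * dist z' z)" by (simp only: e0(2) mult_ac)
      finally show ?thesis using pos by simp
    qed
    then show ?thesis using \<sigma> by blast
  qed
  moreover have "min \<delta> (\<eta>0 / Cp) > 0" using pos \<eta>0 constants_pos by simp
  ultimately show ?thesis by blast
qed

lemma solve_near:
  assumes "z \<in> G" "dist z zbar < \<delta>" "\<sigma> \<le> \<delta> - dist z zbar" "dist y' (snd z) < \<sigma>"
  shows "\<exists>x'. (x', y') \<in> G \<and> dist x' (fst z) \<le> \<mu> * dist y' (snd z)"
proof (rule solve[OF assms(1,2)])
  have "norm y' \<le> dist y' (snd z) + norm (snd z)"
    using norm_triangle_ineq[of "y' - snd z" "snd z"] by (simp add: dist_norm)
  moreover have "norm (snd z) \<le> dist z zbar" using dist_snd_le[of z zbar] by simp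
  ultimately show "norm y' < \<delta>" using assms by linarith
qed

text \<open>
  The Newton equation says that \<open>(- vh, - d)\<close> is normal to the graph. By the symmetric increment
  estimate \<open>(vh, xbar - xh)\<close> is an approximate normal of tolerance \<open>o(\<parallel>(xh, vh) - (xbar, 0)\<parallel>)\<close>. In the
  sum of the two the first components cancel, so that metric regularity bounds the second component
  \<open>xbar - (xh + d)\<close> by the tolerance alone.
\<close>

lemma newton_step_estimate:
  assumes "e > 0"
  shows "\<exists>\<eta>>0. \<forall>xh vh d. (xh, vh) \<in> G \<longrightarrow> dist (xh, vh) zbar < \<eta> \<longrightarrow>
    (- vh, - d) \<in> limiting_normal_cone G (xh, vh) \<longrightarrow> norm (xh + d - xbar) \<le> e * dist (xh, vh) zbar"
proof -
  define e1 where "e1 = e / (1 + \<mu>)"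
  have e1: "e1 > 0" "e1 * (1 + \<mu>) = e" using assms constants_pos by (auto simp: e1_def)
  obtain \<eta>0 where \<eta>0: "\<eta>0 > 0" and sym: "\<And>xh vh. (xh, vh) \<in> G \<Longrightarrow> dist (xh, vh) zbar < \<eta>0 \<Longrightarrow>
    \<exists>\<sigma>>0. \<forall>z\<in>G. \<forall>z'\<in>G. dist z (xh, vh) < \<sigma> \<longrightarrow> dist z' (xh, vh) < \<sigma> \<longrightarrow>
       (vh, xbar - xh) \<bullet> (z' - z) \<le> e1 * dist (xh, vh) zbar * dist z' z"
    using symmetric_increment_on_graph[OF e1(1)] by blast
  have "norm (xh + d - xbar) \<le> e * dist (xh, vh) zbar"
    if zh: "(xh, vh) \<in> G" "dist (xh, vh) zbar < min \<delta> \<eta>0"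
      and N: "(- vh, - d) \<in> limiting_normal_cone G (xh, vh)" for xh vh d
  proof -
    define E where "E = e1 * dist (xh, vh) zbar"
    have E: "E \<ge> 0" using e1 by (simp add: E_def)
    obtain \<sigma>0 where \<sigma>0: "\<sigma>0 > 0" and sym': "\<And>z z'. z\<in>G \<Longrightarrow> z'\<in>G \<Longrightarrow> dist z (xh, vh) < \<sigma>0 \<Longrightarrow>
       dist z' (xh, vh) < \<sigma>0 \<Longrightarrow> (vh, xbar - xh) \<bullet> (z' - z) \<le> E * dist z' z"
      using sym[OF zh(1)] zh(2) unfolding E_def min_less_iff_conj by meson
    define \<sigma> where "\<sigma> = min \<sigma>0 (\<delta> - dist (xh, vh) zbar) / 2"
    have \<sigma>: "\<sigma> > 0" "2 * \<sigma> \<le> \<sigma>0" "2 * \<sigma> \<le> \<delta> - dist (xh, vh) zbar" using \<sigma>0 zh by (auto simp: \<sigma>_def)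
    obtain zs vs where zs: "\<And>k::nat. zs k \<in> G" "\<And>k. vs k \<in> regular_normal_cone G (zs k)"
        "zs \<longlonglongrightarrow> (xh, vh)" "vs \<longlonglongrightarrow> (- vh, - d)"
      using N unfolding limiting_normal_cone_def by blast
    have "norm (xh + d - xbar) \<le> e * dist (xh, vh) zbar + \<tau>" if "\<tau> > 0" for \<tau>
    proof -
      define \<tau>1 where "\<tau>1 = \<tau> / (1 + \<mu>)"
      have \<tau>1: "\<tau>1 > 0" "\<tau>1 * (1 + \<mu>) = \<tau>" using \<open>\<tau> > 0\<close> constants_pos by (auto simp: \<tau>1_def)
      have step: "norm (snd (vs k) + (xbar - xh)) \<le> \<mu> * norm (fst (vs k) + vh) + (e * dist (xh, vh) zbar + \<tau>)"
        if near: "dist (zs k) (xh, vh) < \<sigma>" for k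
      proof -
        obtain \<delta>n where \<delta>n: "\<delta>n > 0"
          "\<And>z. z \<in> G \<Longrightarrow> dist z (zs k) < \<delta>n \<Longrightarrow> vs k \<bullet> (z - zs k) \<le> \<tau>1 * dist z (zs k)"
          using zs(2)[of k] \<tau>1(1) unfolding regular_normal_cone_iff by blast
        have dzk: "dist (zs k) zbar < \<delta>" "\<sigma> \<le> \<delta> - dist (zs k) zbar"
          using dist_triangle[of "zs k" zbar "(xh, vh)"] near \<sigma> by auto
        have "norm (snd (vs k) + (xbar - xh)) \<le> \<mu> * norm (fst (vs k) + vh) + (E + \<tau>1) * (1 + \<mu>)"
        proof (rule approximate_normal_bound[where G = G and x = "fst (zs k)" and y = "snd (zs k)"])
          show "min \<sigma> \<delta>n > 0" using \<sigma> \<delta>n by simp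
          show "\<exists>x'. (x', y') \<in> G \<and> dist x' (fst (zs k)) \<le> \<mu> * dist y' (snd (zs k))"
            if "dist y' (snd (zs k)) < min \<sigma> \<delta>n" for y'
            using solve_near[OF zs(1) dzk] that by auto
          fix z assume z: "z \<in> G" "dist z (fst (zs k), snd (zs k)) < min \<sigma> \<delta>n"
          then have "dist z (xh, vh) < \<sigma>0" "dist (zs k) (xh, vh) < \<sigma>0"
            using dist_triangle[of z "(xh, vh)" "zs k"] near \<sigma> by auto
          then have "(vh, xbar - xh) \<bullet> (z - zs k) \<le> E * dist z (zs k)" using sym' zs(1) z(1) by blast
          moreover have "vs k \<bullet> (z - zs k) \<le> \<tau>1 * dist z (zs k)" using \<delta>n z by auto
          ultimately show "(fst (vs k) + vh, snd (vs k) + (xbar - xh)) \<bullet> (z - (fst (zs k), snd (zs k)))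
              \<le> (E + \<tau>1) * dist z (fst (zs k), snd (zs k))"
            by (simp add: inner_prod_def inner_add_left distrib_right)
        qed (use pos E \<tau>1 in auto)
        also have "(E + \<tau>1) * (1 + \<mu>) = e1 * (1 + \<mu>) * dist (xh, vh) zbar + \<tau>1 * (1 + \<mu>)"
          by (simp add: E_def algebra_simps)
        finally show ?thesis unfolding e1(2) \<tau>1(2) .
      qed
      have "\<forall>\<^sub>F k in sequentially. dist (zs k) (xh, vh) < \<sigma>" using zs(3) \<sigma>(1) by (rule tendstoD)
      then have ev: "\<forall>\<^sub>F k in sequentially. norm (snd (vs k) + (xbar - xh))
          \<le> \<mu> * norm (fst (vs k) + vh) + (e * dist (xh, vh) zbar + \<tau>)"
        by (rule eventually_mono) (rule step)
      have "norm (snd (- vh, - d) + (xbar - xh)) \<le> \<mu> * norm (fst (- vh, - d) + vh) + (e * dist (xh, vh) zbar + \<tau>)"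
        by (rule tendsto_le[OF _ _ _ ev]) (auto intro!: tendsto_eq_intros zs(4))
      moreover have "norm (xh + d - xbar) = norm (snd (- vh, - d) + (xbar - xh))"
        using norm_minus_cancel[of "xh + d - xbar"] by (simp add: algebra_simps)
      ultimately show ?thesis by simp
    qed
    then show ?thesis by (rule field_le_epsilon)
  qed
  moreover have "min \<delta> \<eta>0 > 0" using pos \<eta>0 by simp
  ultimately show ?thesis by blast
qed

text \<open>
  The points \<open>((w - P w) / lam, u \<bullet> P w)\<close> form a Lipschitz image of an \<open>n\<close>-dimensional set in
  dimension \<open>n + 1\<close>.
\<close>

lemma negligible_scalarised_graph:
  "negligible ((\<lambda>w. ((w - P w) /\<^sub>R lam, u \<bullet> P w)) ` ball xbar r)"
proof -
  define f where "f = (\<lambda>(w, s::real). ((w - P w) /\<^sub>R lam, u \<bullet> P w))"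
  define S where "S = ball xbar r \<times> {0::real}"
  have "negligible (f ` S)"
  proof (rule negligible_locally_Lipschitz_image)
    have "negligible {x :: 'a \<times> real. (0, 1) \<bullet> x = 0}" by (rule negligible_hyperplane) (simp add: zero_prod_def)
    then show "negligible S" by (rule negligible_subset) (auto simp: S_def inner_prod_def)
    fix x assume x: "x \<in> S"
    show "\<exists>T B. open T \<and> x \<in> T \<and> (\<forall>y\<in>S \<inter> T. norm (f y - f x) \<le> B * norm (y - x))"
    proof (intro exI[of _ UNIV] exI[of _ "Cc + 2 * norm u"] conjI ballI)
      fix y assume "y \<in> S \<inter> UNIV"
      then obtain a b where ab: "x = (a, 0)" "y = (b, 0)" "a \<in> ball xbar r" "b \<in> ball xbar r"
        using x by (auto simp: S_def)
      have "norm (f y - f x) \<le> dist ((b - P b) /\<^sub>R lam) ((a - P a) /\<^sub>R lam) + dist (u \<bullet> P b) (u \<bullet> P a)"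
        unfolding f_def ab prod.case dist_norm[symmetric] by (rule dist_Pair_le)
      also have "dist ((b - P b) /\<^sub>R lam) ((a - P a) /\<^sub>R lam) \<le> dist (chart b) (chart a)"
        using dist_snd_le[of "chart b" "chart a"] by (simp add: chart_def)
      also have "\<dots> \<le> Cc * norm (b - a)" using dist_chart_le[OF ab(4,3)] by (simp add: dist_norm)
      also have "dist (u \<bullet> P b) (u \<bullet> P a) \<le> norm u * norm (P b - P a)"
        using Cauchy_Schwarz_ineq2[of u "P b - P a"] by (simp add: dist_norm inner_diff_right)
      also have "norm u * norm (P b - P a) \<le> norm u * (2 * norm (b - a))"
        by (intro mult_left_mono P_lipschitz ab) auto
      finally show "norm (f y - f x) \<le> (Cc + 2 * norm u) * norm (y - x)"
        by (simp add: ab algebra_simps)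
    qed auto
  qed simp
  moreover have "f ` S = (\<lambda>w. ((w - P w) /\<^sub>R lam, u \<bullet> P w)) ` ball xbar r"
    by (force simp: f_def S_def)
  ultimately show ?thesis by simp
qed

text \<open>
  Regular normals with first component close to a prescribed \<open>u\<close> arise as multipliers: maximise
  \<open>u \<bullet> x\<close> along the graph, with a penalty that forces \<open>v\<close> towards a parameter \<open>p\<close> close to \<open>vh\<close>. Such
  maximisers could run away from \<open>(xh, vh)\<close>, and therefore the level \<open>u \<bullet> x \<le> q\<close> is imposed, with \<open>q\<close>
  slightly above \<open>u \<bullet> xh\<close>. By metric regularity there is \<open>x1\<close> near \<open>xh\<close> with \<open>(x1, p)\<close> in the graph; the
  term \<open>\<parallel>x - x1\<parallel>\<^sup>2\<close>, which the level bounds by \<open>q - u \<bullet> x1\<close>, keeps maximisers near \<open>x1\<close> and perturbs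
  the normal only slightly. For almost every \<open>(p, q)\<close> no graph point has \<open>v = p\<close> and \<open>u \<bullet> x = q\<close>, so the
  level constraint is inactive for large penalties.
\<close>

lemma regular_normal_near_direction:
  assumes zh: "(xh, vh) \<in> G" "dist (xh, vh) zbar < min \<delta> (r / Cp)" and "\<tau> > 0"
  shows "\<exists>z u' y. z \<in> G \<and> dist z (xh, vh) < \<tau> \<and> norm (u' - u) < \<tau> \<and> (u', y) \<in> regular_normal_cone G z"
proof -
  define D where "D = \<delta> - dist (xh, vh) zbar"
  have D: "D > 0" using zh by (simp add: D_def)
  define wh where "wh = param (xh, vh)"
  have "dist wh xbar \<le> Cp * dist (xh, vh) zbar"
    using dist_param_le[of "(xh, vh)" zbar] by (simp add: wh_def param_zbar)
  also have "\<dots> < r" using zh constants_pos by (simp add: pos_less_divide_eq mult.commute)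
  finally have dwh: "dist wh xbar < r" .
  have cwh: "chart wh = (xh, vh)" using chart_param[OF zh(1)] zh(2) by (simp add: wh_def)
  define \<sigma> where "\<sigma> = min ((r - dist wh xbar) / 2) (min \<tau> D / (2 * Cc))"
  have \<sigma>: "\<sigma> > 0" using dwh D \<open>\<tau> > 0\<close> constants_pos by (auto simp: \<sigma>_def)
  have cancel: "c * (b / (2 * c)) = b / 2" if "c > 0" for b c :: real using that by simp
  have sub: "cball wh \<sigma> \<subseteq> ball xbar r"
  proof
    fix w assume "w \<in> cball wh \<sigma>"
    then have "dist wh w \<le> (r - dist wh xbar) / 2" by (simp add: \<sigma>_def)
    then show "w \<in> ball xbar r" using dist_triangle[of xbar w wh] dwh by (simp add: dist_commute)
  qed
  have chart_close: "dist (chart w) (xh, vh) < min \<tau> D" if w: "w \<in> cball wh \<sigma>" for w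
  proof -
    have "dist (chart w) (chart wh) \<le> Cc * dist w wh" using subsetD[OF sub w] dwh by (intro dist_chart_le) (auto simp: dist_commute)
    also have "\<dots> \<le> Cc * \<sigma>" using w constants_pos by (intro mult_left_mono) (auto simp: dist_commute)
    also have "\<dots> \<le> Cc * (min \<tau> D / (2 * Cc))" using constants_pos by (intro mult_left_mono) (auto simp: \<sigma>_def)
    also have "\<dots> = min \<tau> D / 2" by (rule cancel[OF constants_pos(2)])
    also have "\<dots> < min \<tau> D" using D \<open>\<tau> > 0\<close> by (auto simp: min_def)
    finally show ?thesis by (simp add: cwh)
  qed
  \<comment> \<open>\<open>\<kappa>\<close> bounds the displacement \<open>\<parallel>x - x1\<parallel>\<close> of maximisers, \<open>t\<close> the gap between \<open>q\<close> and \<open>u \<bullet> xh\<close>,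
    and \<open>\<epsilon>\<close> the perturbation of \<open>vh\<close>.\<close>
  define \<kappa> where "\<kappa> = min (\<tau> / 3) (\<sigma> / (2 * Cp))"
  define t where "t = \<kappa>\<^sup>2 / 3"
  define \<epsilon> where "\<epsilon> = min (t / (norm u * \<mu> + 1)) (min (\<sigma> / (2 * (\<mu> + lam))) (D / (2 * (\<mu> + 1))))"
  have \<kappa>: "\<kappa> > 0" "2 * \<kappa> < \<tau>" "Cp * \<kappa> \<le> \<sigma> / 2"
  proof -
    show "\<kappa> > 0" using \<sigma> \<open>\<tau> > 0\<close> constants_pos by (auto simp: \<kappa>_def)
    show "2 * \<kappa> < \<tau>" using \<open>\<tau> > 0\<close> by (auto simp: \<kappa>_def min_def)
    have "Cp * \<kappa> \<le> Cp * (\<sigma> / (2 * Cp))" using constants_pos by (intro mult_left_mono) (auto simp: \<kappa>_def)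
    also have "\<dots> = \<sigma> / 2" by (rule cancel[OF constants_pos(1)])
    finally show "Cp * \<kappa> \<le> \<sigma> / 2" .
  qed
  have t: "t > 0" using \<kappa> by (simp add: t_def)
  have up: "norm u * \<mu> + 1 > 0" "\<mu> + lam > 0" "\<mu> + 1 > 0" using pos by (auto intro: add_nonneg_pos)
  have \<epsilon>: "\<epsilon> > 0" "norm u * (\<mu> * \<epsilon>) \<le> t" "(\<mu> + lam) * \<epsilon> \<le> \<sigma> / 2" "(\<mu> + 1) * \<epsilon> < D"
  proof -
    show "\<epsilon> > 0" using t \<sigma> D up by (auto simp: \<epsilon>_def)
    have le: "c * \<epsilon> \<le> B" if "c > 0" "\<epsilon> \<le> B / c" for c B :: real
      using that by (simp add: pos_le_divide_eq mult.commute)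
    have "(norm u * \<mu> + 1) * \<epsilon> \<le> t" using up by (intro le) (auto simp: \<epsilon>_def)
    then show "norm u * (\<mu> * \<epsilon>) \<le> t" using \<open>\<epsilon> > 0\<close> by (simp add: algebra_simps)
    have "(2 * (\<mu> + lam)) * \<epsilon> \<le> \<sigma>" using up by (intro le) (auto simp: \<epsilon>_def)
    then show "(\<mu> + lam) * \<epsilon> \<le> \<sigma> / 2" by (simp add: algebra_simps)
    have "(2 * (\<mu> + 1)) * \<epsilon> \<le> D" using up by (intro le) (auto simp: \<epsilon>_def)
    then have "2 * ((\<mu> + 1) * \<epsilon>) \<le> D" by (simp only: mult.assoc)
    then show "(\<mu> + 1) * \<epsilon> < D" using D by linarith
  qed
  define I where "I = (\<lambda>w. ((w - P w) /\<^sub>R lam, u \<bullet> P w)) ` ball xbar r"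
  define O' where "O' = ball vh \<epsilon> \<times> {u \<bullet> xh + t <..< u \<bullet> xh + 2 * t}"
  have "open O'" unfolding O'_def by (intro open_Times) auto
  moreover have "(vh, u \<bullet> xh + 3 / 2 * t) \<in> O'" using \<epsilon> t by (simp add: O'_def)
  ultimately have "\<not> negligible O'" using open_not_negligible by blast
  then have "\<not> O' \<subseteq> I"
    unfolding I_def using negligible_subset[OF negligible_scalarised_graph] by blast
  then obtain p q where "(p, q) \<in> O'" and pq: "(p, q) \<notin> I" by (metis subrelI)
  then have p: "dist p vh < \<epsilon>" and q: "u \<bullet> xh + t < q" "q < u \<bullet> xh + 2 * t"
    by (auto simp: O'_def dist_commute)
  have "\<epsilon> \<le> (\<mu> + 1) * \<epsilon>" using pos \<epsilon> by (simp add: algebra_simps)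
  then have "\<epsilon> < D" using \<epsilon> by linarith
  then obtain x1 where x1: "(x1, p) \<in> G" "dist x1 xh \<le> \<mu> * dist p vh"
    using solve_near[OF zh(1) _ _, of D p] p zh(2) by (auto simp: D_def)
  have x1': "dist x1 xh \<le> \<mu> * \<epsilon>" using x1(2) p pos by (meson less_imp_le mult_left_mono order_trans)
  have "\<bar>u \<bullet> (x1 - xh)\<bar> \<le> norm u * norm (x1 - xh)" by (rule Cauchy_Schwarz_ineq2)
  also have "\<dots> \<le> norm u * (\<mu> * \<epsilon>)" using x1' by (intro mult_left_mono) (auto simp: dist_norm)
  finally have ux1: "\<bar>u \<bullet> x1 - u \<bullet> xh\<bar> \<le> t" using \<epsilon> by (simp add: inner_diff_right)
  define w1 where "w1 = param (x1, p)"
  have "dist (x1, p) (xh, vh) \<le> dist x1 xh + dist p vh" by (rule dist_Pair_le)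
  also have "\<dots> < D" using x1' p \<epsilon>(4) by (simp add: algebra_simps)
  finally have "dist (x1, p) zbar < \<delta>" using dist_triangle[of "(x1, p)" zbar "(xh, vh)"] by (simp add: D_def)
  then have cw1: "chart w1 = (x1, p)" unfolding w1_def by (rule chart_param[OF x1(1)])
  have Pw1: "P w1 = x1" "(w1 - P w1) /\<^sub>R lam = p" using cw1 by (auto simp: chart_def)
  have dw1: "dist w1 wh < \<sigma> / 2"
  proof -
    have "dist w1 wh \<le> dist x1 xh + lam * dist p vh"
    proof -
      have "w1 - wh = (x1 - xh) + lam *\<^sub>R (p - vh)" by (simp add: w1_def wh_def param_def algebra_simps)
      then show ?thesis using norm_triangle_ineq[of "x1 - xh" "lam *\<^sub>R (p - vh)"] pos
        by (simp add: dist_norm)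
    qed
    also have "\<dots> < \<mu> * \<epsilon> + lam * \<epsilon>" using x1' p pos by (intro add_le_less_mono mult_strict_left_mono) auto
    also have "\<dots> \<le> \<sigma> / 2" using \<epsilon>(3) by (simp add: algebra_simps)
    finally show ?thesis .
  qed
  define v where "v w = (w - P w) /\<^sub>R lam" for w
  define A where "A = cball wh \<sigma> \<inter> {w. u \<bullet> P w \<le> q}"
  define \<Phi> where "\<Phi> k w = u \<bullet> P w - real (Suc k) * (norm (v w - p))\<^sup>2 - (norm (P w - x1))\<^sup>2" for k :: nat and w
  have contP: "continuous_on (cball wh \<sigma>) P"
    by (rule continuous_on_subset[OF lipschitz_on_continuous_on[OF lipschitz] sub])
  have "closed A"
  proof -
    have "closed {w \<in> cball wh \<sigma>. u \<bullet> P w \<le> q}"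
      by (intro continuous_on_closed_Collect_le continuous_intros contP) auto
    then show ?thesis by (simp add: A_def Int_def)
  qed
  then have cptA: "compact A" unfolding A_def compact_eq_bounded_closed using bounded_cball bounded_Int by blast
  have contv: "continuous_on A v" and contPA: "continuous_on A P"
    using continuous_on_subset[OF contP, of A] by (auto simp: A_def v_def[abs_def] intro!: continuous_intros)
  have w1A: "w1 \<in> A" using dw1 \<sigma> Pw1 ux1 q t by (auto simp: A_def dist_commute)
  have "\<exists>w\<in>A. \<forall>w'\<in>A. \<Phi> k w' \<le> \<Phi> k w" for k
    using w1A by (intro continuous_attains_sup cptA) (auto simp: \<Phi>_def[abs_def] intro!: continuous_intros contv contPA)
  then obtain W where W: "\<And>k. W k \<in> A" and max: "\<And>k w. w \<in> A \<Longrightarrow> \<Phi> k w \<le> \<Phi> k (W k)" by metis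
  have gap: "real (Suc k) * (norm (v (W k) - p))\<^sup>2 + (norm (P (W k) - x1))\<^sup>2 \<le> \<kappa>\<^sup>2" for k
  proof -
    have "u \<bullet> x1 \<le> \<Phi> k (W k)" using max[OF w1A, of k] Pw1 by (simp add: \<Phi>_def v_def)
    moreover have "u \<bullet> P (W k) \<le> q" using W[of k] by (simp add: A_def)
    ultimately show ?thesis using ux1 q unfolding \<Phi>_def t_def by linarith
  qed
  have Pclose: "norm (P (W k) - x1) \<le> \<kappa>" and vclose: "real (Suc k) * (norm (v (W k) - p))\<^sup>2 \<le> \<kappa>\<^sup>2" for k
  proof -
    have "(norm (P (W k) - x1))\<^sup>2 \<le> \<kappa>\<^sup>2" using gap[of k] by (smt (verit) mult_nonneg_nonneg of_nat_0_le_iff zero_le_power2)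
    then show "norm (P (W k) - x1) \<le> \<kappa>" using \<kappa> by (simp add: power2_le_iff_abs_le)
    show "real (Suc k) * (norm (v (W k) - p))\<^sup>2 \<le> \<kappa>\<^sup>2" using gap[of k] by (smt (verit) zero_le_power2)
  qed
  have inside: "dist (W k) wh < \<sigma>" for k
  proof -
    have "(norm (v (W k) - p))\<^sup>2 \<le> real (Suc k) * (norm (v (W k) - p))\<^sup>2"
      by (intro mult_le_cancel_right1[THEN iffD2]) auto
    then have "norm (v (W k) - p) \<le> \<kappa>" 
      using power2_le_imp_le[OF order_trans[OF _ vclose[of k]]] \<kappa>(1) by simp
    moreover have "norm (W k - w1) = norm ((P (W k) - x1) + lam *\<^sub>R (v (W k) - p))"
      using pos by (simp add: v_def w1_def param_def algebra_simps)
    moreover have "\<dots> \<le> norm (P (W k) - x1) + lam * norm (v (W k) - p)"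
      using norm_triangle_ineq[of "P (W k) - x1" "lam *\<^sub>R (v (W k) - p)"] pos by simp
    ultimately have "norm (W k - w1) \<le> \<kappa> + lam * \<kappa>"
      using Pclose[of k] pos by (smt (verit) mult_left_mono)
    also have "\<dots> \<le> \<sigma> / 2" using \<kappa>(3) by (simp add: algebra_simps)
    finally have "dist (W k) w1 \<le> \<sigma> / 2" by (simp add: dist_norm)
    then show ?thesis using dist_triangle[of "W k" wh w1] dw1 by linarith
  qed
  have "\<exists>k. u \<bullet> P (W k) < q"
  proof (rule ccontr)
    assume "\<not> ?thesis"
    then have eq: "u \<bullet> P (W k) = q" for k using W[of k] by (auto simp: A_def not_less intro: antisym)
    obtain w0 s where w0: "w0 \<in> A" and s: "strict_mono (s :: nat \<Rightarrow> nat)" and lim: "(W \<circ> s) \<longlonglongrightarrow> w0"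
      using cptA[unfolded compact_def, rule_format, of W] W by blast
    have "(\<lambda>k. u \<bullet> P (W (s k))) \<longlonglongrightarrow> u \<bullet> P w0"
      using continuous_on_tendsto_compose[OF contPA lim w0] W by (intro tendsto_intros) (simp add: o_def)
    then have "u \<bullet> P w0 = q" unfolding eq by (simp add: LIMSEQ_const_iff)
    moreover have "v w0 = p"
    proof -
      have "(\<lambda>k. v (W (s k))) \<longlonglongrightarrow> v w0"
        using continuous_on_tendsto_compose[OF contv lim w0] W by (simp add: o_def)
      then have "(\<lambda>k. (norm (v (W (s k)) - p))\<^sup>2) \<longlonglongrightarrow> (norm (v w0 - p))\<^sup>2" by (intro tendsto_intros)
      moreover have "(\<lambda>k. (norm (v (W (s k)) - p))\<^sup>2) \<longlonglongrightarrow> 0"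
      proof (rule Lim_null_comparison)
        have "(\<lambda>k. \<kappa>\<^sup>2 * (1 / real (Suc k))) \<longlonglongrightarrow> \<kappa>\<^sup>2 * 0"
          by (intro tendsto_intros LIMSEQ_Suc[OF lim_1_over_n])
        then have "(\<lambda>k. \<kappa>\<^sup>2 / real (Suc k)) \<longlonglongrightarrow> 0" by simp
        then show "(\<lambda>k. \<kappa>\<^sup>2 / real (Suc (s k))) \<longlonglongrightarrow> 0"
          using LIMSEQ_subseq_LIMSEQ[OF _ s] by (fastforce simp: o_def)
        have "(norm (v (W k) - p))\<^sup>2 \<le> \<kappa>\<^sup>2 / real (Suc k)" for k
          using vclose[of k] by (simp add: pos_le_divide_eq mult.commute del: of_nat_Suc)
        then show "\<forall>\<^sub>F k in sequentially. norm ((norm (v (W (s k)) - p))\<^sup>2) \<le> \<kappa>\<^sup>2 / real (Suc (s k))"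
          by simp
      qed
      ultimately have "(norm (v w0 - p))\<^sup>2 = 0" using LIMSEQ_unique by blast
      then show ?thesis by simp
    qed
    moreover have "w0 \<in> ball xbar r" using w0 sub by (auto simp: A_def)
    ultimately have "(p, q) \<in> I" unfolding I_def v_def by force
    then show False using pq by blast
  qed
  then obtain k where k: "u \<bullet> P (W k) < q" by blast
  define K where "K = real (Suc k)"
  have K: "K > 0" by (simp add: K_def)
  define z where "z = chart (W k)"
  define u' where "u' = u - 2 *\<^sub>R (P (W k) - x1)"
  define y where "y = - (2 * K) *\<^sub>R (v (W k) - p)"
  have Wk: "W k \<in> cball wh \<sigma>" using W[of k] by (simp add: A_def)
  have z: "z \<in> G" "dist z (xh, vh) < \<tau>" "dist z (xh, vh) < D"
    using chart_mem[of "W k"] chart_close[OF Wk] Wk sub by (auto simp: z_def chart_def)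
  have z_simps: "fst z = P (W k)" "snd z = v (W k)" by (auto simp: z_def chart_def v_def)
  have "(u', y) \<in> regular_normal_cone G z"
  proof (rule proximal_normal_imp_regular)
    define \<rho> where "\<rho> = min ((\<sigma> - dist (W k) wh) / Cp) (min (D - dist z (xh, vh)) ((q - u \<bullet> P (W k)) / (norm u + 1)))"
    have nu: "norm u + 1 > 0" by (simp add: add_nonneg_pos)
    show "\<rho> > 0" using inside[of k] z k constants_pos nu by (simp add: \<rho>_def)
    fix z' assume z': "z' \<in> G" "dist z' z < \<rho>"
    define w where "w = param z'"
    have "dist z' zbar < \<delta>"
      using dist_triangle[of z' zbar "(xh, vh)"] dist_triangle[of z' "(xh, vh)" z] z'(2)
      by (simp add: \<rho>_def D_def)
    then have cw: "chart w = z'" unfolding w_def by (rule chart_param[OF z'(1)])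
    then have w_simps: "P w = fst z'" "v w = snd z'" by (auto simp: chart_def v_def)
    have "dist w (W k) \<le> Cp * dist z' z" using dist_param_le[of z' z] by (simp add: w_def z_def param_chart)
    also have "\<dots> < \<sigma> - dist (W k) wh"
      using z'(2) constants_pos by (simp add: \<rho>_def pos_less_divide_eq mult.commute)
    finally have "w \<in> cball wh \<sigma>" using dist_triangle[of wh w "W k"] by (simp add: dist_commute)
    moreover have "u \<bullet> P w \<le> q"
    proof -
      have "u \<bullet> (P w - P (W k)) \<le> norm u * norm (P w - P (W k))" by (rule norm_cauchy_schwarz)
      also have "\<dots> \<le> (norm u + 1) * dist z' z"
        using dist_fst_le[of z' z] by (intro mult_mono) (auto simp: dist_norm w_simps z_simps)
      also have "\<dots> \<le> q - u \<bullet> P (W k)"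
        using z'(2) nu by (simp add: \<rho>_def pos_less_divide_eq mult.commute)
      finally show ?thesis by (simp add: inner_diff_right)
    qed
    ultimately have "\<Phi> k w \<le> \<Phi> k (W k)" by (intro max) (simp add: A_def)
    then have le: "u \<bullet> (fst z' - fst z) \<le> K * ((norm (snd z' - p))\<^sup>2 - (norm (snd z - p))\<^sup>2)
        + ((norm (fst z' - x1))\<^sup>2 - (norm (fst z - x1))\<^sup>2)"
      unfolding \<Phi>_def K_def w_simps z_simps by (simp only: inner_diff_right right_diff_distrib)
    have sq: "(norm (b - c))\<^sup>2 - (norm (a - c))\<^sup>2 = 2 * ((a - c) \<bullet> (b - a)) + (norm (b - a))\<^sup>2" for a b c :: 'a
      by (simp add: power2_norm_eq_inner inner_diff_left inner_diff_right inner_commute)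
    have "(u', y) \<bullet> (z' - z) = u \<bullet> (fst z' - fst z) - 2 * ((fst z - x1) \<bullet> (fst z' - fst z))
        - K * (2 * ((snd z - p) \<bullet> (snd z' - snd z)))"
      unfolding u'_def y_def inner_prod_def z_simps[symmetric] by (simp add: inner_diff_left)
    also have "\<dots> \<le> K * (norm (snd z' - snd z))\<^sup>2 + (norm (fst z' - fst z))\<^sup>2"
      using le unfolding sq distrib_left by linarith
    also have "\<dots> \<le> K * (dist z' z)\<^sup>2 + (dist z' z)\<^sup>2"
      using K dist_fst_le[of z' z] dist_snd_le[of z' z]
      by (intro add_mono mult_left_mono power_mono) (auto simp: dist_norm)
    finally show "(u', y) \<bullet> (z' - z) \<le> (K + 1) * (dist z' z)\<^sup>2" by (simp add: distrib_right)
  qed (rule z)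
  moreover have "norm (u' - u) < \<tau>" using Pclose[of k] \<kappa>(2) by (simp add: u'_def)
  ultimately show ?thesis using z by blast
qed

lemma limiting_normal_exists:
  assumes zh: "(xh, vh) \<in> G" "dist (xh, vh) zbar < min \<delta> (r / Cp)"
  shows "\<exists>y. (u, y) \<in> limiting_normal_cone G (xh, vh)"
proof -
  define D where "D = \<delta> - dist (xh, vh) zbar"
  have D: "D > 0" using zh by (simp add: D_def)
  define \<tau> where "\<tau> k = min D (1 / real (Suc k))" for k
  have \<tau>: "\<tau> k > 0" for k using D by (simp add: \<tau>_def)
  have "\<exists>z u' y. z \<in> G \<and> dist z (xh, vh) < \<tau> k \<and> norm (u' - u) < \<tau> k \<and> (u', y) \<in> regular_normal_cone G z"
    for k by (rule regular_normal_near_direction[OF zh \<tau>])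
  then obtain z us y where z: "\<And>k. z k \<in> G" "\<And>k. dist (z k) (xh, vh) < \<tau> k"
    and us: "\<And>k. norm (us k - u) < \<tau> k" and N: "\<And>k. (us k, y k) \<in> regular_normal_cone G (z k)" by metis
  have \<tau>0: "\<tau> \<longlonglongrightarrow> 0"
    by (rule Lim_null_comparison[OF _ LIMSEQ_Suc[OF lim_1_over_n]])
       (use D in \<open>auto simp: \<tau>_def abs_of_pos intro!: always_eventually\<close>)
  have zl: "z \<longlonglongrightarrow> (xh, vh)"
    by (rule metric_tendsto_imp_tendsto[OF \<tau>0]) (use z(2) \<tau> in \<open>auto simp: less_imp_le abs_of_pos intro!: always_eventually\<close>)
  have ul: "us \<longlonglongrightarrow> u"
    by (rule metric_tendsto_imp_tendsto[OF \<tau>0]) (use us \<tau> in \<open>auto simp: dist_norm less_imp_le abs_of_pos intro!: always_eventually\<close>)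
  have yb: "norm (y k) \<le> \<mu> * (norm u + D)" for k
  proof -
    have dz: "dist (z k) zbar < \<delta>"
      using dist_triangle[of "z k" zbar "(xh, vh)"] z(2)[of k] by (simp add: \<tau>_def D_def)
    have "norm (y k) \<le> \<mu> * norm (us k) + e" if "e > 0" for e
    proof -
      define e1 where "e1 = e / (1 + \<mu>)"
      have e1: "e1 > 0" "e1 * (1 + \<mu>) = e" using that constants_pos by (auto simp: e1_def)
      obtain \<delta>n where \<delta>n: "\<delta>n > 0"
        "\<And>w. w \<in> G \<Longrightarrow> dist w (z k) < \<delta>n \<Longrightarrow> (us k, y k) \<bullet> (w - z k) \<le> e1 * dist w (z k)"
        using N[of k] e1 unfolding regular_normal_cone_iff by blast
      have "norm (y k) \<le> \<mu> * norm (us k) + e1 * (1 + \<mu>)"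
      proof (rule approximate_normal_bound[where G = G and x = "fst (z k)" and y = "snd (z k)"])
        show "min \<delta>n (\<delta> - dist (z k) zbar) > 0" using \<delta>n dz by simp
        show "\<exists>x'. (x', y') \<in> G \<and> dist x' (fst (z k)) \<le> \<mu> * dist y' (snd (z k))"
          if "dist y' (snd (z k)) < min \<delta>n (\<delta> - dist (z k) zbar)" for y'
          using solve_near[OF z(1) dz order_refl] that by auto
        show "(us k, y k) \<bullet> (w - (fst (z k), snd (z k))) \<le> e1 * dist w (fst (z k), snd (z k))"
          if "w \<in> G" "dist w (fst (z k), snd (z k)) < min \<delta>n (\<delta> - dist (z k) zbar)" for w
          using \<delta>n(2)[of w] that by simp
      qed (use pos e1 in auto)
      then show ?thesis using e1 by simp
    qed
    then have "norm (y k) \<le> \<mu> * norm (us k)" by (rule field_le_epsilon)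
    moreover have "norm (us k) \<le> norm u + D"
      using norm_triangle_sub[of "us k" u] us[of k] by (simp add: \<tau>_def)
    ultimately show ?thesis using pos by (meson less_imp_le mult_left_mono order_trans)
  qed
  then have "bounded (range y)" by (auto intro!: boundedI)
  then obtain y0 s where s: "strict_mono (s :: nat \<Rightarrow> nat)" and yl: "(y \<circ> s) \<longlonglongrightarrow> y0"
    using bounded_imp_convergent_subsequence by blast
  have "(u, y0) \<in> limiting_normal_cone G (xh, vh)"
    unfolding limiting_normal_cone_def
  proof (intro CollectI conjI exI allI zh(1))
    show "z (s k) \<in> G" "(us (s k), y (s k)) \<in> regular_normal_cone G (z (s k))" for k
      using z N by auto
    show "(\<lambda>k. z (s k)) \<longlonglongrightarrow> (xh, vh)" using LIMSEQ_subseq_LIMSEQ[OF zl s] by (simp add: o_def)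
    show "(\<lambda>k. (us (s k), y (s k))) \<longlonglongrightarrow> (u, y0)"
      using LIMSEQ_subseq_LIMSEQ[OF ul s] yl by (intro tendsto_Pair) (simp_all add: o_def)
  qed
  then show ?thesis ..
qed

end

section \<open>The proximal chart of a prox-regular function\<close>

lemma regular_normal_tangent:
  assumes v: "v \<in> regular_normal_cone \<Omega> z"
    and mem: "\<forall>\<^sub>F t in at_right (0::real). z + t *\<^sub>R d t \<in> \<Omega>"
    and lim: "(d \<longlongrightarrow> d0) (at_right 0)"
  shows "v \<bullet> d0 \<le> 0"
proof -
  have bound: "v \<bullet> d0 \<le> e * norm d0" if "e > 0" for e :: real
  proof -
    obtain \<delta> where \<delta>: "\<delta> > 0" "\<And>w. w \<in> \<Omega> \<Longrightarrow> dist w z < \<delta> \<Longrightarrow> v \<bullet> (w - z) \<le> e * dist w z"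
      using v \<open>e > 0\<close> unfolding regular_normal_cone_iff by blast
    have "((\<lambda>t. t *\<^sub>R d t) \<longlongrightarrow> 0 *\<^sub>R d0) (at_right 0)" by (intro tendsto_intros lim)
    then have "\<forall>\<^sub>F t in at_right 0. dist (t *\<^sub>R d t) 0 < \<delta>" using \<delta>(1) by (intro tendstoD) auto
    moreover have "\<forall>\<^sub>F t in at_right (0::real). t > 0" by (rule eventually_at_right_less)
    ultimately have "\<forall>\<^sub>F t in at_right 0. v \<bullet> d t \<le> e * norm (d t)" using mem
    proof eventually_elim
      case (elim t)
      then have "v \<bullet> (t *\<^sub>R d t) \<le> e * norm (t *\<^sub>R d t)" using \<delta>(2)[of "z + t *\<^sub>R d t"] by (simp add: dist_norm)
      then have "t * (v \<bullet> d t) \<le> t * (e * norm (d t))" using elim by (simp add: mult_ac)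
      then show ?case using elim by simp
    qed
    then show ?thesis by (rule tendsto_le[rotated 3]) (auto intro!: tendsto_intros lim)
  qed
  have "v \<bullet> d0 \<le> 0 + e" if "e > 0" for e
  proof -
    have "e / (norm d0 + 1) * norm d0 \<le> e"
      using that by (simp add: pos_divide_le_eq add_nonneg_pos)
    then show ?thesis using bound[of "e / (norm d0 + 1)"] that by (simp add: add_nonneg_pos)
  qed
  then show ?thesis by (rule field_le_epsilon)
qed

lemma epi_shift: "(x, r - c) \<in> epi (\<lambda>x. \<psi> x - ereal (g x)) \<longleftrightarrow> (x, r) \<in> epi \<psi>" if "c = g x"
  using that by (cases "\<psi> x") (auto simp: epi_def)

text \<open>
  The epigraph of an \<open>s\<close>-convex function contains, with any two points, a parabolic arc between
  them. Its initial direction is tangent, and testing limiting normals with it gives the global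
  subgradient inequality.
\<close>

lemma s_convex_subgradient:
  assumes conv: "s_convex s \<psi>" and v: "v \<in> subdiff \<psi> x"
  shows "\<psi> x + ereal (v \<bullet> (y - x) + s / 2 * (norm (y - x))\<^sup>2) \<le> \<psi> y"
proof (cases "\<psi> y")
  case (real b)
  define C where "C = epi (\<lambda>x. \<psi> x - ereal (s / 2 * (norm x)\<^sup>2))"
  have C: "convex C" and ninf: "\<And>x. \<psi> x \<noteq> -\<infinity>" using conv by (auto simp: s_convex_def C_def)
  obtain a where a: "\<psi> x = ereal a" using v ninf[of x] by (cases "\<psi> x") (auto simp: subdiff_def)
  have yb: "(y, b) \<in> epi \<psi>" by (simp add: epi_def real)
  have key: "v' \<bullet> (y - x') + \<alpha> * (b - r - s / 2 * (norm (y - x'))\<^sup>2) \<le> 0"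
    if N: "(v', \<alpha>) \<in> regular_normal_cone (epi \<psi>) (x', r)" for v' \<alpha> x' r
  proof -
    define S where "S = s / 2 * (norm (y - x'))\<^sup>2"
    have xr: "(x', r) \<in> epi \<psi>" using N by (simp add: regular_normal_cone_iff)
    have "(v', \<alpha>) \<bullet> (y - x', b - r - S + 0 * S) \<le> 0"
    proof (rule regular_normal_tangent[OF N])
      show "((\<lambda>t. (y - x', b - r - S + t * S)) \<longlongrightarrow> (y - x', b - r - S + 0 * S)) (at_right 0)"
        by (intro tendsto_intros)
      show "\<forall>\<^sub>F t in at_right 0. (x', r) + t *\<^sub>R (y - x', b - r - S + t * S) \<in> epi \<psi>"
        unfolding eventually_at_right_field
      proof (intro exI[of _ 1] conjI allI impI)
        fix t :: real assume t: "0 < t" "t < 1"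
        define xt where "xt = x' + t *\<^sub>R (y - x')"
        have xt: "xt = (1 - t) *\<^sub>R x' + t *\<^sub>R y" by (simp add: xt_def algebra_simps)
        have "(1 - t) *\<^sub>R (x', r - s / 2 * (norm x')\<^sup>2) + t *\<^sub>R (y, b - s / 2 * (norm y)\<^sup>2) \<in> C"
          using xr yb t unfolding C_def by (intro convexD[OF C[unfolded C_def]]) (auto simp: epi_shift)
        moreover have nxt: "(norm xt)\<^sup>2 = (1 - t) * (norm x')\<^sup>2 + t * (norm y)\<^sup>2 - t * (1 - t) * (norm (y - x'))\<^sup>2"
          by (simp add: xt power2_norm_eq_inner inner_commute algebra_simps)
        have "(1 - t) * (r - s / 2 * (norm x')\<^sup>2) + t * (b - s / 2 * (norm y)\<^sup>2)
            = (r + t * (b - r - S + t * S)) - s / 2 * (norm xt)\<^sup>2"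
          unfolding nxt S_def by (simp add: field_simps)
        ultimately have "(xt, (r + t * (b - r - S + t * S)) - s / 2 * (norm xt)\<^sup>2) \<in> C"
          by (simp add: xt)
        then show "(x', r) + t *\<^sub>R (y - x', b - r - S + t * S) \<in> epi \<psi>"
          unfolding C_def by (simp add: epi_shift xt_def)
      qed simp
    qed
    then show ?thesis by (simp add: S_def)
  qed
  obtain zs vs where zs: "\<And>k::nat. vs k \<in> regular_normal_cone (epi \<psi>) (zs k)"
      and zl: "zs \<longlonglongrightarrow> (x, a)" and vl: "vs \<longlonglongrightarrow> (v, -1)"
    using v unfolding subdiff_def limiting_normal_cone_def by (auto simp: a)
  have "fst (vs k) \<bullet> (y - fst (zs k)) + snd (vs k) * (b - snd (zs k) - s / 2 * (norm (y - fst (zs k)))\<^sup>2) \<le> 0" for k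
    using zs[of k] by (intro key) simp
  moreover have "(\<lambda>k. fst (vs k) \<bullet> (y - fst (zs k)) + snd (vs k) * (b - snd (zs k) - s / 2 * (norm (y - fst (zs k)))\<^sup>2))
      \<longlonglongrightarrow> fst (v, - 1::real) \<bullet> (y - fst (x, a)) + snd (v, -1) * (b - snd (x, a) - s / 2 * (norm (y - fst (x, a)))\<^sup>2)"
    by (intro tendsto_intros zl vl)
  ultimately have "fst (v, - 1::real) \<bullet> (y - fst (x, a)) + snd (v, -1) * (b - snd (x, a) - s / 2 * (norm (y - fst (x, a)))\<^sup>2) \<le> 0"
    using LIMSEQ_le_const2 by blast
  then show ?thesis by (simp add: a real)
qed (use conv in \<open>auto simp: s_convex_def\<close>)

lemma proximal_minorant_imp_subdiff:
  assumes fx: "\<phi> x = ereal a" and "\<delta> > 0"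
    and minor: "\<And>y. dist y x < \<delta> \<Longrightarrow> ereal (a + v \<bullet> (y - x) - K * (norm (y - x))\<^sup>2) \<le> \<phi> y"
  shows "v \<in> subdiff \<phi> x"
proof -
  have "(v, -1) \<in> regular_normal_cone (epi \<phi>) (x, a)"
  proof (rule proximal_normal_imp_regular)
    show "(x, a) \<in> epi \<phi>" "\<delta> > 0" using assms by (auto simp: epi_def)
    fix w assume w: "w \<in> epi \<phi>" "dist w (x, a) < \<delta>"
    obtain y \<rho> where y: "w = (y, \<rho>)" by (cases w)
    have d: "dist y x \<le> dist w (x, a)" using dist_fst_le[of w "(x, a)"] by (simp add: y)
    have "ereal (a + v \<bullet> (y - x) - K * (norm (y - x))\<^sup>2) \<le> ereal \<rho>"
      by (rule order_trans[OF minor]) (use w d in \<open>auto simp: epi_def y\<close>)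
    then have "(v, -1) \<bullet> (w - (x, a)) \<le> K * (dist y x)\<^sup>2" by (simp add: y dist_norm)
    also have "\<dots> \<le> \<bar>K\<bar> * (dist w (x, a))\<^sup>2" using d by (intro mult_mono power_mono) auto
    finally show "(v, -1) \<bullet> (w - (x, a)) \<le> \<bar>K\<bar> * (dist w (x, a))\<^sup>2" .
  qed
  then have "(v, -1) \<in> limiting_normal_cone (epi \<phi>) (x, a)"
    unfolding limiting_normal_cone_def mem_Collect_eq
    by (intro conjI exI[of _ "\<lambda>_::nat. (x, a)"] exI[of _ "\<lambda>_::nat. (v, - 1::real)"])
       (auto simp: epi_def fx)
  then show ?thesis by (simp add: subdiff_def fx)
qed

lemma closed_epi:
  fixes \<phi> :: "'a::metric_space \<Rightarrow> ereal"
  assumes "lsc_fun \<phi>"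
  shows "closed (epi \<phi>)"
  unfolding closed_def open_contains_ball
proof (intro ballI)
  fix z assume "z \<in> - epi \<phi>"
  then obtain x r where z: "z = (x, r)" "ereal r < \<phi> x" by (cases z) (auto simp: epi_def)
  then obtain c where c: "ereal r < ereal c" "ereal c < \<phi> x" using ereal_dense2 by blast
  have "ereal c < Liminf (at x) \<phi>" using c assms by (auto simp: lsc_fun_def intro: less_le_trans)
  then have "\<forall>\<^sub>F y in at x. ereal c < \<phi> y" by (rule less_LiminfD)
  then obtain d where d: "d > 0" "\<And>y. y \<noteq> x \<Longrightarrow> dist y x < d \<Longrightarrow> ereal c < \<phi> y"
    unfolding eventually_at by auto
  have "ball z (min d (c - r)) \<subseteq> - epi \<phi>"
  proof
    fix w assume w: "w \<in> ball z (min d (c - r))"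
    have "dist (fst w) x < d" "\<bar>snd w - r\<bar> < c - r"
      using w dist_fst_le[of w z] dist_snd_le[of w z] by (auto simp: z dist_commute dist_real_def)
    then have "ereal (snd w) < ereal c" "ereal c < \<phi> (fst w)" using d(2)[of "fst w"] c by auto
    then have "\<not> \<phi> (fst w) \<le> ereal (snd w)" by (meson less_trans not_le)
    then show "w \<in> - epi \<phi>" by (simp add: epi_def case_prod_beta)
  qed
  then show "\<exists>e>0. ball z e \<subseteq> - epi \<phi>" using d c by (intro exI[of _ "min d (c - r)"]) auto
qed

text \<open>
  Minimising the height \<open>\<rho> + h y\<close> over a compact piece of the epigraph replaces the extended-valued
  lower semicontinuous objective by a continuous one.
\<close>

lemma lsc_plus_continuous_attains_min:
  fixes \<phi> :: "'a::metric_space \<Rightarrow> ereal"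
  assumes "lsc_fun \<phi>" "compact K" and x0: "x0 \<in> K" "\<phi> x0 = ereal a"
    and low: "\<And>y. y \<in> K \<Longrightarrow> ereal m \<le> \<phi> y" and h: "continuous_on K h" "\<And>y. y \<in> K \<Longrightarrow> 0 \<le> h y"
  shows "\<exists>y\<in>K. \<exists>b. \<phi> y = ereal b \<and> (\<forall>y'\<in>K. ereal (b + h y) \<le> \<phi> y' + ereal (h y'))"
proof -
  define M where "M = a + h x0"
  define E where "E = epi \<phi> \<inter> (K \<times> {m..M})"
  have "compact E"
    unfolding E_def using closed_epi[OF assms(1)] assms(2) by (intro closed_Int_compact compact_Times) auto
  moreover have x0E: "(x0, a) \<in> E" using x0 low[OF x0(1)] h(2)[OF x0(1)] by (auto simp: E_def M_def epi_def)
  moreover have "continuous_on E (\<lambda>z. snd z + h (fst z))"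
    by (intro continuous_intros continuous_on_compose2[OF h(1)]) (auto simp: E_def)
  ultimately obtain z where z: "z \<in> E" and min: "\<And>z'. z' \<in> E \<Longrightarrow> snd z + h (fst z) \<le> snd z' + h (fst z')"
    using continuous_attains_inf[of E "\<lambda>z. snd z + h (fst z)"] by blast
  obtain y \<rho> where yr: "z = (y, \<rho>)" by (cases z)
  have y: "y \<in> K" "\<phi> y \<le> ereal \<rho>" "\<rho> \<le> M" using z by (auto simp: yr E_def epi_def)
  obtain b where b: "\<phi> y = ereal b" using low[OF y(1)] y(2) by (cases "\<phi> y") auto
  have "b \<le> \<rho>" using y b by simp
  have "ereal (b + h y) \<le> \<phi> y' + ereal (h y')" if y': "y' \<in> K" for y'
  proof (cases "\<phi> y' \<le> ereal M")
    case True
    then obtain b' where b': "\<phi> y' = ereal b'" using low[OF y'] by (cases "\<phi> y'") auto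
    then have "(y', b') \<in> E" using y' low[OF y'] True by (auto simp: E_def epi_def)
    then show ?thesis using min[of "(y', b')"] b' \<open>b \<le> \<rho>\<close> by (simp add: yr)
  next
    case False
    have "b + h y \<le> M" using min[OF x0E] \<open>b \<le> \<rho>\<close> by (simp add: yr M_def)
    then have "ereal (b + h y) \<le> \<phi> y'" using False by (meson ereal_less_eq(3) linear order_trans)
    then show ?thesis using h(2)[OF y'] by (cases "\<phi> y'") auto
  qed
  then show ?thesis using y(1) b by blast
qed

lemma has_derivative_if_quadratic_error:
  fixes \<psi> :: "'a::real_inner \<Rightarrow> real"
  assumes "\<rho> > 0" and err: "\<And>y. y \<in> ball x \<rho> \<Longrightarrow> \<bar>\<psi> y - \<psi> x - p \<bullet> (y - x)\<bar> \<le> K * (norm (y - x))\<^sup>2"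
  shows "(\<psi> has_derivative (\<lambda>h. p \<bullet> h)) (at x)"
  unfolding has_derivative_at_alt
proof (intro conjI allI impI)
  show "bounded_linear (\<lambda>h. p \<bullet> h)" by (rule bounded_linear_inner_right)
  fix e :: real assume "e > 0"
  show "\<exists>d>0. \<forall>y. norm (y - x) < d \<longrightarrow> norm (\<psi> y - \<psi> x - p \<bullet> (y - x)) \<le> e * norm (y - x)"
  proof (intro exI conjI allI impI)
    show "min \<rho> (e / (\<bar>K\<bar> + 1)) > 0" using assms \<open>e > 0\<close> by auto
    fix y assume y: "norm (y - x) < min \<rho> (e / (\<bar>K\<bar> + 1))"
    have "norm (\<psi> y - \<psi> x - p \<bullet> (y - x)) \<le> K * (norm (y - x))\<^sup>2"
      using err[of y] y by (simp add: dist_norm norm_minus_commute)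
    also have "\<dots> \<le> (\<bar>K\<bar> + 1) * (norm (y - x))\<^sup>2" by (intro mult_right_mono) auto
    also have "\<dots> = ((\<bar>K\<bar> + 1) * norm (y - x)) * norm (y - x)" by (simp add: power2_eq_square)
    also have "\<dots> \<le> e * norm (y - x)"
      using y by (intro mult_right_mono) (auto simp: pos_less_divide_eq mult.commute intro: less_imp_le)
    finally show "norm (\<psi> y - \<psi> x - p \<bullet> (y - x)) \<le> e * norm (y - x)" .
  qed
qed

text \<open>
  Subdifferential continuity makes the function value condition in the definition of variational
  \<open>s\<close>-convexity automatic near \<open>(xbar, 0)\<close>, so that the inequality of the \<open>s\<close>-convex minorant transfers to
  all nearby subgradients of \<open>\<phi>\<close> itself.
\<close>

lemma uniform_subgradient_inequality:
  assumes cpr: "continuously_prox_regular \<phi> xbar 0"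
  obtains s \<rho> where "s \<le> 0" "\<rho> > 0"
    "\<And>x v y. (x, v) \<in> gph (subdiff \<phi>) \<Longrightarrow> dist x xbar \<le> \<rho> \<Longrightarrow> norm v \<le> \<rho> \<Longrightarrow> dist y xbar \<le> \<rho> \<Longrightarrow>
       \<phi> x + ereal (v \<bullet> (y - x) + s / 2 * (norm (y - x))\<^sup>2) \<le> \<phi> y"
proof -
  obtain s where s: "s \<le> 0" and var: "variationally_s_convex s \<phi> xbar 0"
    and cont: "subdifferentially_continuous \<phi> xbar 0"
    using cpr by (auto simp: continuously_prox_regular_def prox_regular_def)
  obtain \<phi>' U V \<epsilon> where \<epsilon>: "\<epsilon> > 0" and conv: "s_convex s \<phi>'"
    and U: "xbar \<in> interior U" and V: "0 \<in> interior V" and le: "\<forall>x\<in>U. \<phi>' x \<le> \<phi> x"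
    and eq: "(U \<times> V) \<inter> gph (subdiff \<phi>') = ({x \<in> U. \<phi> x < \<phi> xbar + ereal \<epsilon>} \<times> V) \<inter> gph (subdiff \<phi>)"
    and val: "\<forall>(x, v) \<in> (U \<times> V) \<inter> gph (subdiff \<phi>'). \<phi>' x = \<phi> x"
    and sub0: "0 \<in> subdiff \<phi> xbar" and prp: "proper_fun \<phi>"
    using var unfolding variationally_s_convex_def by blast
  obtain a where a: "\<phi> xbar = ereal a"
    using sub0 prp by (cases "\<phi> xbar") (auto simp: subdiff_def proper_fun_def)
  obtain d1 where d1: "d1 > 0" "ball xbar d1 \<subseteq> U" using U by (meson mem_interior)
  obtain d2 where d2: "d2 > 0" "ball 0 d2 \<subseteq> V" using V by (meson mem_interior)
  obtain d3 where d3: "d3 > 0" and near: "\<And>x v. (x, v) \<in> gph (subdiff \<phi>) \<Longrightarrow> norm (x - xbar) \<le> d3 \<Longrightarrow>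
      norm v \<le> d3 \<Longrightarrow> \<bar>\<phi> x - \<phi> xbar\<bar> < ereal \<epsilon>"
    using cont \<epsilon> unfolding subdifferentially_continuous_def by (metis (no_types, lifting) case_prodD diff_zero)
  define \<rho> where "\<rho> = min (min d1 d2 / 2) d3"
  have \<rho>: "\<rho> > 0" "\<rho> < d1" "\<rho> < d2" "\<rho> \<le> d3" using d1 d2 d3 by (auto simp: \<rho>_def min_def)
  show thesis
  proof (rule that[OF s \<rho>(1)])
    fix x v y assume xv: "(x, v) \<in> gph (subdiff \<phi>)" "dist x xbar \<le> \<rho>" "norm v \<le> \<rho>" and y: "dist y xbar \<le> \<rho>"
    have xU: "x \<in> U" "v \<in> V" "y \<in> U" using xv y \<rho> d1 d2 by (auto simp: subset_iff dist_commute)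
    have "\<bar>\<phi> x - \<phi> xbar\<bar> < ereal \<epsilon>" using xv \<rho> by (intro near) (auto simp: dist_norm)
    then have "\<phi> x < \<phi> xbar + ereal \<epsilon>" unfolding a by (cases "\<phi> x") auto
    then have "(x, v) \<in> (U \<times> V) \<inter> gph (subdiff \<phi>')" unfolding eq using xU xv by auto
    then have "v \<in> subdiff \<phi>' x" "\<phi>' x = \<phi> x" using val by (auto simp: gph_def)
    then show "\<phi> x + ereal (v \<bullet> (y - x) + s / 2 * (norm (y - x))\<^sup>2) \<le> \<phi> y"
      using s_convex_subgradient[OF conv, of v x y] le xU by (metis order_trans)
  qed
qed

text \<open>
  For small \<open>lam\<close> the function \<open>\<phi> + \<parallel>\<cdot> - w\<parallel>\<^sup>2 / (2 lam)\<close> has a minimiser \<open>P w\<close> close to \<open>xbar\<close>, and its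
  optimality condition puts \<open>(P w, (w - P w) / lam)\<close> into the graph. Hypomonotonicity of the
  subdifferential makes such points unique and \<open>P\<close> Lipschitz. The function
  \<open>\<psi> w = w \<bullet> P w - \<parallel>P w\<parallel>\<^sup>2 / 2 - lam \<phi> (P w)\<close> is the conjugate of \<open>\<parallel>\<cdot>\<parallel>\<^sup>2 / 2 + lam \<phi>\<close>, localised, and
  hence has the subgradient \<open>P w\<close> at \<open>w\<close>; as \<open>P\<close> is Lipschitz, it is a gradient.
\<close>

lemma prox_regular_chart:
  fixes \<phi> :: "'a::euclidean_space \<Rightarrow> ereal"
  assumes prp: "proper_fun \<phi>" and lsc: "lsc_fun \<phi>" and sub0: "0 \<in> subdiff \<phi> xbar"
    and cpr: "continuously_prox_regular \<phi> xbar 0"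
  obtains lam r \<delta> P \<psi> where "lam > 0" "r > 0" "\<delta> > 0"
    "\<And>w. w \<in> ball xbar r \<Longrightarrow> (P w, (w - P w) /\<^sub>R lam) \<in> gph (subdiff \<phi>)"
    "\<And>z. z \<in> gph (subdiff \<phi>) \<Longrightarrow> dist z (xbar, 0) < \<delta> \<Longrightarrow> P (fst z + lam *\<^sub>R snd z) = fst z"
    "2-lipschitz_on (ball xbar r) P"
    "\<And>w. w \<in> ball xbar r \<Longrightarrow> (\<psi> has_derivative (\<lambda>h. P w \<bullet> h)) (at w)"
proof -
  obtain s \<rho> where s: "s \<le> 0" and \<rho>: "\<rho> > 0"
    and ineq: "\<And>x v y. (x, v) \<in> gph (subdiff \<phi>) \<Longrightarrow> dist x xbar \<le> \<rho> \<Longrightarrow> norm v \<le> \<rho> \<Longrightarrow> dist y xbar \<le> \<rho> \<Longrightarrow>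
       \<phi> x + ereal (v \<bullet> (y - x) + s / 2 * (norm (y - x))\<^sup>2) \<le> \<phi> y"
    by (rule uniform_subgradient_inequality[OF cpr]) blast
  define f where "f x = real_of_ereal (\<phi> x)" for x
  have fin: "\<phi> x = ereal (f x)" if "(x, v) \<in> gph (subdiff \<phi>)" for x v
    using that prp by (cases "\<phi> x") (auto simp: gph_def subdiff_def proper_fun_def f_def)
  have g0: "(xbar, 0) \<in> gph (subdiff \<phi>)" using sub0 by (simp add: gph_def)
  define a where "a = f xbar"
  have a: "\<phi> xbar = ereal a" using fin[OF g0] by (simp add: a_def)
  have low: "ereal (a + s / 2 * (norm (y - xbar))\<^sup>2) \<le> \<phi> y" if "dist y xbar \<le> \<rho>" for y
    using ineq[OF g0 _ _ that] \<rho> by (simp add: a)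
  define N where "N = {(x, v) \<in> gph (subdiff \<phi>). dist x xbar \<le> \<rho> \<and> norm v \<le> \<rho>}"
  have Nineq: "f x + v \<bullet> (x' - x) + s / 2 * (norm (x' - x))\<^sup>2 \<le> f x'" if "(x, v) \<in> N" "(x', v') \<in> N" for x v x' v'
    using that ineq[of x v x'] fin[of x v] fin[of x' v'] by (auto simp: N_def)
  \<comment> \<open>This choice gives \<open>lam * \<bar>s\<bar> \<le> 1 / 4\<close>, so that the quadratic term dominates the concavity of \<open>\<phi>\<close>.\<close>
  define lam where "lam = 1 / (4 * (1 - s))"
  have lam: "lam > 0" "lam \<le> 1 / 4" using s by (auto simp: lam_def divide_simps)
  have ls: "- 1 / 4 \<le> lam * s" using s by (simp add: lam_def divide_simps)
  have expand: "norm (x - x') \<le> 2 * norm ((x + lam *\<^sub>R v) - (x' + lam *\<^sub>R v'))"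
    if N: "(x, v) \<in> N" "(x', v') \<in> N" for x v x' v'
  proof -
    define D where "D = (norm (x - x'))\<^sup>2"
    have "v \<bullet> (x' - x) + s / 2 * D + (v' \<bullet> (x - x') + s / 2 * D) \<le> 0"
      using Nineq[OF N] Nineq[OF N(2,1)] unfolding D_def norm_minus_commute[of x' x] by linarith
    then have "s * D \<le> (v - v') \<bullet> (x - x')" by (simp add: algebra_simps)
    then have "lam * (s * D) \<le> lam * ((v - v') \<bullet> (x - x'))" using lam by (intro mult_left_mono) auto
    then have "D + lam * s * D \<le> ((x - x') + lam *\<^sub>R (v - v')) \<bullet> (x - x')"
      by (simp add: D_def power2_norm_eq_inner inner_add_left mult.assoc)
    moreover have "- 1 / 4 * D \<le> lam * s * D" using ls by (intro mult_right_mono) (auto simp: D_def)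
    moreover have "((x - x') + lam *\<^sub>R (v - v')) \<bullet> (x - x') \<le> norm ((x - x') + lam *\<^sub>R (v - v')) * norm (x - x')"
      by (rule norm_cauchy_schwarz)
    moreover have "D \<ge> 0" by (simp add: D_def)
    ultimately have "D \<le> 2 * (norm ((x - x') + lam *\<^sub>R (v - v')) * norm (x - x'))" by linarith
    moreover have "(x - x') + lam *\<^sub>R (v - v') = (x + lam *\<^sub>R v) - (x' + lam *\<^sub>R v')" by (simp add: algebra_simps)
    ultimately have "norm (x - x') * norm (x - x') \<le> (2 * norm ((x + lam *\<^sub>R v) - (x' + lam *\<^sub>R v'))) * norm (x - x')"
      by (simp add: D_def power2_eq_square)
    then show ?thesis by (cases "x = x'") auto
  qed
  define r where "r = \<rho> * lam / 4"
  have r: "r > 0" using \<rho> lam by (simp add: r_def)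
  have ex: "\<exists>y. (y, (w - y) /\<^sub>R lam) \<in> N" if w: "w \<in> ball xbar r" for w
  proof -
    define h where "h y = (norm (y - w))\<^sup>2 / (2 * lam)" for y
    have "\<exists>y\<in>cball xbar \<rho>. \<exists>b. \<phi> y = ereal b \<and> (\<forall>y'\<in>cball xbar \<rho>. ereal (b + h y) \<le> \<phi> y' + ereal (h y'))"
    proof (rule lsc_plus_continuous_attains_min[OF lsc compact_cball _ a])
      show "xbar \<in> cball xbar \<rho>" using \<rho> by simp
      show "continuous_on (cball xbar \<rho>) h"
        using lam unfolding h_def[abs_def] by (intro continuous_intros) auto
      show "0 \<le> h y" for y using lam by (simp add: h_def)
      fix y assume y: "y \<in> cball xbar \<rho>"
      then have "(norm (y - xbar))\<^sup>2 \<le> \<rho>\<^sup>2" by (intro power_mono) (auto simp: dist_norm norm_minus_commute)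
      then have "s / 2 * \<rho>\<^sup>2 \<le> s / 2 * (norm (y - xbar))\<^sup>2" using s by (intro mult_left_mono_neg) auto
      then have "ereal (a + s / 2 * \<rho>\<^sup>2) \<le> ereal (a + s / 2 * (norm (y - xbar))\<^sup>2)" by simp
      also have "\<dots> \<le> \<phi> y" using y by (intro low) (simp add: dist_commute)
      finally show "ereal (a + s / 2 * \<rho>\<^sup>2) \<le> \<phi> y" .
    qed
    then obtain y b where y: "dist y xbar \<le> \<rho>" and b: "\<phi> y = ereal b"
      and min: "\<And>y'. dist y' xbar \<le> \<rho> \<Longrightarrow> ereal (b + h y) \<le> \<phi> y' + ereal (h y')"
      by (metis mem_cball dist_commute)
    define D where "D = norm (xbar - w)"
    have D: "D \<ge> 0" "D < r" using w by (auto simp: D_def dist_norm)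
    have "norm (y - w) \<le> 2 * D"
    proof -
      have "b + h y \<le> a + h xbar" using min[of xbar] \<rho> by (simp add: a)
      moreover have "a + s / 2 * (norm (y - xbar))\<^sup>2 \<le> b" using low[OF y] by (simp add: b)
      ultimately have "h y + s / 2 * (norm (y - xbar))\<^sup>2 \<le> h xbar" by linarith
      then have "2 * lam * (h y + s / 2 * (norm (y - xbar))\<^sup>2) \<le> 2 * lam * h xbar"
        using lam by (intro mult_left_mono) auto
      then have "(norm (y - w))\<^sup>2 + lam * s * (norm (y - xbar))\<^sup>2 \<le> D\<^sup>2"
        using lam by (simp add: h_def D_def distrib_left)
      moreover have "- 1 / 4 * (norm (y - xbar))\<^sup>2 \<le> lam * s * (norm (y - xbar))\<^sup>2"
        using ls by (intro mult_right_mono) auto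
      moreover have "(norm (y - xbar))\<^sup>2 \<le> (norm (y - w) + D)\<^sup>2"
        using norm_triangle_ineq[of "y - w" "w - xbar"]
        by (intro power_mono) (simp_all add: D_def norm_minus_commute[of xbar])
      moreover have "(norm (y - w) + D)\<^sup>2 \<le> 2 * (norm (y - w))\<^sup>2 + 2 * D\<^sup>2"
        using sum_squares_bound[of "norm (y - w)" D] by (simp add: power2_sum)
      ultimately have "(norm (y - w))\<^sup>2 \<le> 3 * D\<^sup>2" by linarith
      also have "\<dots> \<le> (2 * D)\<^sup>2" by (simp add: power_mult_distrib)
      finally show ?thesis by (rule power2_le_imp_le) (use D in simp)
    qed
    moreover have "dist y xbar \<le> norm (y - w) + D"
      using norm_triangle_ineq[of "y - w" "w - xbar"] by (simp add: D_def dist_norm norm_minus_commute)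
    moreover have "3 * r < \<rho>" "2 * r \<le> lam * \<rho>" using lam \<rho> by (auto simp: r_def)
    ultimately have yin: "dist y xbar < \<rho>" and yw: "norm (y - w) \<le> lam * \<rho>" using D by linarith+
    define v where "v = (w - y) /\<^sub>R lam"
    have "norm v = norm (w - y) / lam" 
      unfolding v_def norm_scaleR using lam(1) by (simp add: abs_of_pos divide_inverse)
    then have "norm v = norm (y - w) / lam" by (simp only: norm_minus_commute[of w y])
    then have nv: "norm v \<le> \<rho>" using yw lam by (simp add: pos_divide_le_eq mult.commute)
    have "v \<in> subdiff \<phi> y"
    proof (rule proximal_minorant_imp_subdiff[of \<phi> y b "\<rho> - dist y xbar" v "1 / (2 * lam)"])
      fix y' assume "dist y' y < \<rho> - dist y xbar"
      then have "ereal (b + h y) \<le> \<phi> y' + ereal (h y')"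
        using dist_triangle[of y' xbar y] by (intro min) simp
      moreover have "v \<bullet> (y' - y) - 1 / (2 * lam) * (norm (y' - y))\<^sup>2 = h y - h y'"
      proof -
        have "(norm (y' - w))\<^sup>2 = (norm (y - w))\<^sup>2 - 2 * ((w - y) \<bullet> (y' - y)) + (norm (y' - y))\<^sup>2"
          by (simp add: power2_norm_eq_inner inner_diff_left inner_diff_right inner_commute)
        moreover have "v \<bullet> (y' - y) = ((w - y) \<bullet> (y' - y)) / lam" by (simp add: v_def divide_inverse)
        ultimately show ?thesis using lam(1) by (simp add: h_def field_simps)
      qed
      ultimately show "ereal (b + v \<bullet> (y' - y) - 1 / (2 * lam) * (norm (y' - y))\<^sup>2) \<le> \<phi> y'"
        by (cases "\<phi> y'") auto
    qed (use b yin in simp_all)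
    then have "(y, v) \<in> N" using yin nv by (simp add: N_def gph_def)
    then show ?thesis unfolding v_def by blast
  qed
  define P where "P w = (SOME y. (y, (w - y) /\<^sub>R lam) \<in> N)" for w
  have PN: "(P w, (w - P w) /\<^sub>R lam) \<in> N" if "w \<in> ball xbar r" for w
    unfolding P_def using someI_ex[OF ex[OF that]] .
  have recover: "P w + lam *\<^sub>R ((w - P w) /\<^sub>R lam) = w" for w using lam by simp
  have lip: "norm (P w - P w') \<le> 2 * norm (w - w')" if "w \<in> ball xbar r" "w' \<in> ball xbar r" for w w'
    using expand[OF PN PN, OF that] unfolding recover .
  define \<psi> where "\<psi> w = w \<bullet> P w - (norm (P w))\<^sup>2 / 2 - lam * f (P w)" for w
  have mono: "P w \<bullet> (w' - w) \<le> \<psi> w' - \<psi> w" if ww: "w \<in> ball xbar r" "w' \<in> ball xbar r" for w w'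
  proof -
    define d where "d = P w - P w'"
    define v' where "v' = (w' - P w') /\<^sub>R lam"
    have "f (P w') + v' \<bullet> d + s / 2 * (norm d)\<^sup>2 \<le> f (P w)"
      using Nineq[OF PN[OF ww(2)] PN[OF ww(1)]] by (simp add: d_def v'_def)
    then have "lam * (f (P w') + v' \<bullet> d + s / 2 * (norm d)\<^sup>2) \<le> lam * f (P w)"
      using lam by (intro mult_left_mono) auto
    moreover have "lam * (v' \<bullet> d) = (w' - P w') \<bullet> d" using lam by (simp add: v'_def)
    ultimately have "lam * f (P w') + (w' - P w') \<bullet> d + lam * s * (norm d)\<^sup>2 / 2 \<le> lam * f (P w)"
      by (simp add: distrib_left mult.assoc)
    moreover have "- 1 / 4 * (norm d)\<^sup>2 \<le> lam * s * (norm d)\<^sup>2" using ls by (intro mult_right_mono) auto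
    moreover have "(norm (P w))\<^sup>2 = (norm (P w'))\<^sup>2 + 2 * (P w' \<bullet> d) + (norm d)\<^sup>2"
      by (simp add: d_def power2_norm_eq_inner inner_diff_left inner_diff_right inner_commute)
    moreover have "(w' - P w') \<bullet> d = w' \<bullet> P w - w' \<bullet> P w' - P w' \<bullet> d"
      by (simp add: d_def inner_diff_left inner_diff_right)
    moreover have "P w \<bullet> (w' - w) = w' \<bullet> P w - w \<bullet> P w" by (simp add: inner_diff_right inner_commute)
    moreover have "(norm d)\<^sup>2 \<ge> 0" by simp
    ultimately show ?thesis unfolding \<psi>_def by linarith
  qed
  show thesis
  proof (rule that[of lam r "min \<rho> (r / (1 + lam))" P \<psi>])
    show "min \<rho> (r / (1 + lam)) > 0" using \<rho> r lam by simp
    show "(P w, (w - P w) /\<^sub>R lam) \<in> gph (subdiff \<phi>)" if "w \<in> ball xbar r" for w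
      using PN[OF that] by (simp add: N_def)
    show "2-lipschitz_on (ball xbar r) P" by (rule lipschitz_onI) (auto simp: dist_norm intro: lip)
    show "P (fst z + lam *\<^sub>R snd z) = fst z"
      if z: "z \<in> gph (subdiff \<phi>)" "dist z (xbar, 0) < min \<rho> (r / (1 + lam))" for z
    proof -
      define w where "w = fst z + lam *\<^sub>R snd z"
      have d: "dist (fst z) xbar \<le> dist z (xbar, 0)" "norm (snd z) \<le> dist z (xbar, 0)"
        using dist_fst_le[of z "(xbar, 0)"] dist_snd_le[of z "(xbar, 0)"] by auto
      then have zN: "(fst z, snd z) \<in> N" using z by (simp add: N_def case_prod_beta)
      have "dist w xbar \<le> dist (fst z) xbar + lam * norm (snd z)"
        using norm_triangle_ineq[of "fst z - xbar" "lam *\<^sub>R snd z"] lam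
        by (simp add: w_def dist_norm algebra_simps)
      also have "\<dots> \<le> dist z (xbar, 0) + lam * dist z (xbar, 0)"
        using d lam by (intro add_mono mult_left_mono) auto
      also have "\<dots> = (1 + lam) * dist z (xbar, 0)" by (simp add: algebra_simps)
      also have "\<dots> < r" using z lam by (simp add: pos_less_divide_eq mult.commute)
      finally have "w \<in> ball xbar r" by (simp add: dist_commute)
      from expand[OF PN[OF this] zN] show ?thesis unfolding recover by (simp add: w_def)
    qed
    show "(\<psi> has_derivative (\<lambda>h. P w \<bullet> h)) (at w)" if w: "w \<in> ball xbar r" for w
    proof (rule has_derivative_if_quadratic_error[of "r - dist xbar w" _ _ _ 2])
      show "r - dist xbar w > 0" using w by simp
      fix w' assume "w' \<in> ball w (r - dist xbar w)"
      then have w': "w' \<in> ball xbar r" using dist_triangle[of xbar w' w] by simp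
      have "\<psi> w' - \<psi> w \<le> P w' \<bullet> (w' - w)" using mono[OF w' w] by (simp add: inner_diff_right)
      then have "\<bar>\<psi> w' - \<psi> w - P w \<bullet> (w' - w)\<bar> \<le> (P w' - P w) \<bullet> (w' - w)"
        using mono[OF w w'] by (simp add: inner_diff_left)
      also have "\<dots> \<le> norm (P w' - P w) * norm (w' - w)" by (rule norm_cauchy_schwarz)
      also have "\<dots> \<le> (2 * norm (w' - w)) * norm (w' - w)" using lip[OF w' w] by (intro mult_right_mono) auto
      finally show "\<bar>\<psi> w' - \<psi> w - P w \<bullet> (w' - w)\<bar> \<le> 2 * (norm (w' - w))\<^sup>2" by (simp add: power2_eq_square)
    qed
  qed (use lam r in auto)
qed

section \<open>Local convergence of the Newton algorithm\<close>

lemma Q_superlinear_if_contracting: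
  fixes X :: "nat \<Rightarrow> 'a::real_normed_vector"
  assumes contr: "\<And>e. e > 0 \<Longrightarrow> \<exists>R>0. \<forall>k. dist (X k) xbar < R \<longrightarrow> dist (X (Suc k)) xbar \<le> e * dist (X k) xbar"
    and half: "\<And>k. dist (X k) xbar < R0 \<Longrightarrow> dist (X (Suc k)) xbar \<le> 1 / 2 * dist (X k) xbar"
    and start: "dist (X 0) xbar < R0"
  shows "Q_superlinear X xbar"
proof -
  have geo: "dist (X k) xbar < R0 \<and> dist (X k) xbar \<le> (1 / 2) ^ k * R0" for k
  proof (induction k)
    case (Suc k)
    then have *: "dist (X (Suc k)) xbar \<le> 1 / 2 * dist (X k) xbar" by (intro half) blast
    then have "dist (X (Suc k)) xbar \<le> 1 / 2 * ((1 / 2) ^ k * R0)" using Suc by linarith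
    moreover have "dist (X (Suc k)) xbar < R0" using * Suc zero_le_dist[of "X k" xbar] by linarith
    ultimately show ?case by simp
  qed (use start in simp)
  have "(\<lambda>k. (1 / 2) ^ k * R0) \<longlonglongrightarrow> 0"
    by (intro tendsto_mult_left_zero LIMSEQ_power_zero) simp
  moreover have "\<forall>\<^sub>F k in sequentially. norm (dist (X k) xbar) \<le> (1 / 2) ^ k * R0"
    using geo by (intro always_eventually) simp
  ultimately have "(\<lambda>k. dist (X k) xbar) \<longlonglongrightarrow> 0" by (rule Lim_null_comparison[rotated])
  then have lim: "X \<longlonglongrightarrow> xbar" by (rule iffD2[OF tendsto_dist_iff])
  moreover have "(\<lambda>k. norm (X (Suc k) - xbar) / norm (X k - xbar)) \<longlonglongrightarrow> 0"
  proof (rule tendstoI)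
    fix e :: real assume "e > 0"
    then obtain R where R: "R > 0" "\<And>k. dist (X k) xbar < R \<Longrightarrow> dist (X (Suc k)) xbar \<le> e / 2 * dist (X k) xbar"
      using contr[of "e / 2"] by auto
    have "\<forall>\<^sub>F k in sequentially. dist (X k) xbar < R" using lim R(1) by (rule tendstoD)
    then show "\<forall>\<^sub>F k in sequentially. dist (norm (X (Suc k) - xbar) / norm (X k - xbar)) 0 < e"
    proof (rule eventually_mono)
      fix k assume "dist (X k) xbar < R"
      then have "norm (X (Suc k) - xbar) \<le> e / 2 * norm (X k - xbar)" using R(2) by (simp add: dist_norm)
      then have "norm (X (Suc k) - xbar) / norm (X k - xbar) \<le> e / 2"
        using \<open>e > 0\<close> by (cases "X k = xbar") (auto simp: pos_divide_le_eq)
      then have "norm (X (Suc k) - xbar) / norm (X k - xbar) < e" using \<open>e > 0\<close> by linarith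
      then show "dist (norm (X (Suc k) - xbar) / norm (X k - xbar)) 0 < e" by simp
    qed
  qed
  ultimately show ?thesis by (simp add: Q_superlinear_def)
qed

theorem theorem3p11:
  fixes \<phi> :: "real ^ 'n \<Rightarrow> ereal" and xbar :: "real ^ 'n" and \<eta> :: real
  assumes "proper_fun \<phi>" and "lsc_fun \<phi>" and "prox_bounded \<phi>"
    and "0 \<in> subdiff \<phi> xbar"
    and "metrically_regular (subdiff \<phi>) xbar 0"
    and "semismooth_star (subdiff \<phi>) xbar 0"
    and "continuously_prox_regular \<phi> xbar 0"
    and "\<eta> > 0"
  shows "\<exists>U. open U \<and> xbar \<in> U \<and>
    (\<forall>x0\<in>U. newton_executable \<phi> xbar \<eta> x0 \<and>
       (\<forall>X. newton_run \<phi> xbar \<eta> X \<and> X 0 = x0 \<longrightarrow>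
          (\<exists>N. 0 \<in> subdiff \<phi> (X N)) \<or> Q_superlinear X xbar))"
proof -
  obtain lam r \<delta>1 P \<psi> where chart: "lam > 0" "r > 0" "\<delta>1 > 0"
    "\<And>w. w \<in> ball xbar r \<Longrightarrow> (P w, (w - P w) /\<^sub>R lam) \<in> gph (subdiff \<phi>)"
    "\<And>z. z \<in> gph (subdiff \<phi>) \<Longrightarrow> dist z (xbar, 0) < \<delta>1 \<Longrightarrow> P (fst z + lam *\<^sub>R snd z) = fst z"
    "2-lipschitz_on (ball xbar r) P"
    "\<And>w. w \<in> ball xbar r \<Longrightarrow> (\<psi> has_derivative (\<lambda>h. P w \<bullet> h)) (at w)"
    using prox_regular_chart[OF assms(1,2,4,7)] by metis
  obtain \<mu> \<delta>2 where reg: "\<mu> > 0" "\<delta>2 > 0"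
    "\<And>x y y'. y \<in> subdiff \<phi> x \<Longrightarrow> dist x xbar < \<delta>2 \<Longrightarrow> dist y' 0 < \<delta>2 \<Longrightarrow>
       \<exists>x'. y' \<in> subdiff \<phi> x' \<and> dist x' x \<le> \<mu> * dist y' y"
    using metrically_regular_solve[OF assms(5)] by metis
  interpret semismooth_chart "gph (subdiff \<phi>)" xbar lam r "min \<delta>1 \<delta>2" \<mu> P \<psi>
  proof
    show "min \<delta>1 \<delta>2 > 0" using chart(3) reg(2) by simp
    show "(xbar, 0) \<in> gph (subdiff \<phi>)" using assms(4) by (simp add: gph_def)
    show "P (fst z + lam *\<^sub>R snd z) = fst z"
      if "z \<in> gph (subdiff \<phi>)" "dist z (xbar, 0) < min \<delta>1 \<delta>2" for z using chart(5) that by simp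
    show "\<exists>x'. (x', y') \<in> gph (subdiff \<phi>) \<and> dist x' (fst z) \<le> \<mu> * dist y' (snd z)"
      if z: "z \<in> gph (subdiff \<phi>)" "dist z (xbar, 0) < min \<delta>1 \<delta>2" "norm y' < min \<delta>1 \<delta>2" for z y'
    proof -
      have "snd z \<in> subdiff \<phi> (fst z)" using z by (auto simp: gph_def)
      moreover have "dist (fst z) xbar < \<delta>2" using z dist_fst_le[of z "(xbar, 0)"] by simp
      ultimately show ?thesis using reg(3)[of "snd z" "fst z" y'] z by (simp add: gph_def)
    qed
    show "\<exists>\<delta>>0. \<forall>z n. dist z (xbar, 0) < \<delta> \<longrightarrow> n \<in> regular_normal_cone (gph (subdiff \<phi>)) z \<longrightarrow>
        \<bar>n \<bullet> (z - (xbar, 0))\<bar> \<le> \<epsilon> * norm n * dist z (xbar, 0)" if "\<epsilon> > 0" for \<epsilon>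
      by (rule semismooth_star_uniform[OF assms(6) that])
  qed (use chart reg in auto)
  have near: "dist (xh, vh) zbar \<le> \<eta> * dist x xbar" "(xh, vh) \<in> gph (subdiff \<phi>)"
    if "approximate_step \<phi> xbar \<eta> x xh vh" for x xh vh
    using that by (auto simp: approximate_step_def dist_norm)
  have contraction: "\<exists>R>0. \<forall>x x'. dist x xbar < R \<longrightarrow> newton_iteration \<phi> xbar \<eta> x x' \<longrightarrow>
      dist x' xbar \<le> e * dist x xbar" if "e > 0" for e
  proof -
    have "e / \<eta> > 0" using that assms(8) by simp
    then obtain R where R: "R > 0" and est: "\<And>xh vh d. (xh, vh) \<in> gph (subdiff \<phi>) \<Longrightarrow> dist (xh, vh) zbar < R \<Longrightarrow>
        (- vh, - d) \<in> limiting_normal_cone (gph (subdiff \<phi>)) (xh, vh) \<Longrightarrow>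
        norm (xh + d - xbar) \<le> e / \<eta> * dist (xh, vh) zbar"
      using newton_step_estimate by blast
    have "dist x' xbar \<le> e * dist x xbar"
      if x: "dist x xbar < R / \<eta>" and it: "newton_iteration \<phi> xbar \<eta> x x'" for x x'
    proof -
      obtain xh vh d where step: "approximate_step \<phi> xbar \<eta> x xh vh" "newton_direction \<phi> xh vh d" "x' = xh + d"
        using it by (auto simp: newton_iteration_def)
      note z = near[OF step(1)]
      have "\<eta> * dist x xbar < R" using x assms(8) by (simp add: pos_less_divide_eq mult.commute)
      then have "norm (xh + d - xbar) \<le> e / \<eta> * dist (xh, vh) zbar"
        using step(2) z by (intro est) (auto simp: newton_direction_def second_subdiff_def coderivative_def)
      also have "\<dots> \<le> e / \<eta> * (\<eta> * dist x xbar)" using z \<open>e / \<eta> > 0\<close> by (intro mult_left_mono) auto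
      finally show ?thesis using assms(8) by (simp add: step(3) dist_norm)
    qed
    then show ?thesis using R assms(8) by (intro exI[of _ "R / \<eta>"]) auto
  qed
  obtain R1 where R1: "R1 > 0" and half: "\<And>x x'. dist x xbar < R1 \<Longrightarrow> newton_iteration \<phi> xbar \<eta> x x' \<Longrightarrow>
      dist x' xbar \<le> 1 / 2 * dist x xbar"
    using contraction[of "1 / 2"] by auto
  define R2 where "R2 = min (min \<delta>1 \<delta>2) (r / Cp)"
  have R2: "R2 > 0" using pos constants_pos by (simp add: R2_def)
  define R0 where "R0 = min R1 (R2 / \<eta>)"
  have R0: "R0 > 0" using R1 R2 assms(8) by (simp add: R0_def)
  have direction: "\<exists>d. newton_direction \<phi> xh vh d"
    if x: "dist x xbar < R0" and step: "approximate_step \<phi> xbar \<eta> x xh vh" for x xh vh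
  proof -
    have "\<eta> * dist x xbar < R2" using x assms(8) by (simp add: R0_def pos_less_divide_eq mult.commute)
    then have "dist (xh, vh) zbar < min (min \<delta>1 \<delta>2) (r / Cp)" using near(1)[OF step] by (simp only: R2_def[symmetric])
    then obtain y where "(- vh, y) \<in> limiting_normal_cone (gph (subdiff \<phi>)) (xh, vh)"
      using limiting_normal_exists[OF near(2)[OF step]] by blast
    then have "newton_direction \<phi> xh vh (- y)"
      by (simp add: newton_direction_def second_subdiff_def coderivative_def)
    then show ?thesis ..
  qed
  have exec: "newton_executable \<phi> xbar \<eta> x0" if x0: "dist x0 xbar < R0" for x0
    unfolding newton_executable_def
  proof (intro allI impI conjI)
    fix x assume x: "(newton_iteration \<phi> xbar \<eta>)\<^sup>*\<^sup>* x0 x \<and> 0 \<notin> subdiff \<phi> x"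
    then have "(newton_iteration \<phi> xbar \<eta>)\<^sup>*\<^sup>* x0 x" by blast
    then have "dist x xbar < R0"
    proof induction
      case (step x x')
      then have "dist x' xbar \<le> 1 / 2 * dist x xbar" by (intro half) (auto simp: R0_def)
      then show ?case using step zero_le_dist[of x xbar] by linarith
    qed (rule x0)
    then show "\<exists>d. newton_direction \<phi> xh vh d" if "approximate_step \<phi> xbar \<eta> x xh vh" for xh vh
      using direction that by blast
    have "approximate_step \<phi> xbar \<eta> x xbar 0"
      using assms(4,8) by (simp add: approximate_step_def gph_def)
    then show "\<exists>xh vh. approximate_step \<phi> xbar \<eta> x xh vh" by blast
  qed
  have "(\<exists>N. 0 \<in> subdiff \<phi> (X N)) \<or> Q_superlinear X xbar"
    if X: "newton_run \<phi> xbar \<eta> X" "dist (X 0) xbar < R0" for X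
  proof (rule disjCI)
    assume "\<not> Q_superlinear X xbar"
    show "\<exists>N. 0 \<in> subdiff \<phi> (X N)"
    proof (rule ccontr)
      assume "\<not> ?thesis"
      then have it: "newton_iteration \<phi> xbar \<eta> (X k) (X (Suc k))" for k
        using X(1) by (auto simp: newton_run_def)
      have "Q_superlinear X xbar"
      proof (rule Q_superlinear_if_contracting[where ?R0.0 = R0])
        show "dist (X (Suc k)) xbar \<le> 1 / 2 * dist (X k) xbar" if "dist (X k) xbar < R0" for k
          using that it by (intro half) (auto simp: R0_def)
        show "\<exists>R>0. \<forall>k. dist (X k) xbar < R \<longrightarrow> dist (X (Suc k)) xbar \<le> e * dist (X k) xbar" if "e > 0" for e
          using contraction[OF that] it by blast
      qed (rule X(2))
      then show False using \<open>\<not> Q_superlinear X xbar\<close> by blast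
    qed
  qed
  then show ?thesis
    using exec R0 by (intro exI[of _ "ball xbar R0"]) (auto simp: dist_commute)
qed

end
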